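(* Let $X$ be a homogeneous geodesic metric space. The following are equivalent: (a) every asymptotic cone of $X$ is one-ended; (b) $X$ is wide; (c) no asymptotic cone of $X$ has a local cut-point.
   Context: Homogeneous means that the isometry group acts transitively. Asymptotic cones: for an ultrafilter $\omega$ on $\mathbb N$, a sequence $e=(e_n)$ of points of $X$, and a sequence $d=(d_n)$ of positive reals that is $\omega$-divergent (i.e. $\omega(\{n : d_n>M\})=1$ for every $M$), $\mathrm{Con}^\omega(X,e,d)$ is the set of sequences $(x_n)\in\prod X$ with $\lim^\omega \mathrm{dist}(x_n,e_n)/d_n<\infty$, modulo the equivalence relation $\lim^\omega \mathrm{dist}(x_n,y_n)/d_n=0$, with metric $\lim^\omega \mathrm{dist}(x_n,y_n)/d_n$. A metric space $Y$ is one-ended if $Y\setminus B$ has a unique unbounded connected component for every bounded subset $B$ of $Y$. For $Y$ connected and locally connected, $x\in Y$ is a local cut-point if there is an open connected neighborhood $U$ of $x$ such that $U\setminus\{x\}$ has at least two connected components, and a global cut-point if $Y\setminus\{x\}$ has at least two connected components. $X$ is wide if none of its asymptotic cones has a global cut-point.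
   Formalization: The equivalence of (a) with (b) is stated only for unbounded X: if X is non-empty and bounded (e.g. a point), all its asymptotic cones are points, which have no cut-points but also no unbounded component, so (a) fails while (b) and (c) hold. (b)⇔(c) is stated for every X. *)

theory Defs
  imports "HOL-Analysis.Analysis"
begin

section \<open>Metric notions\<close>

definition geodesic_metric :: "'a metric \<Rightarrow> bool" where
  "geodesic_metric X \<longleftrightarrow>
     (\<forall>x\<in>mspace X. \<forall>y\<in>mspace X. \<exists>\<gamma>::real \<Rightarrow> 'a.
        \<gamma> ` {0..mdist X x y} \<subseteq> mspace X \<and> \<gamma> 0 = x \<and> \<gamma> (mdist X x y) = y \<and>
        (\<forall>s\<in>{0..mdist X x y}. \<forall>t\<in>{0..mdist X x y}. mdist X (\<gamma> s) (\<gamma> t) = \<bar>s - t\<bar>))"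

definition self_isometry :: "'a metric \<Rightarrow> ('a \<Rightarrow> 'a) \<Rightarrow> bool" where
  "self_isometry X f \<longleftrightarrow>
     bij_betw f (mspace X) (mspace X) \<and>
     (\<forall>x\<in>mspace X. \<forall>y\<in>mspace X. mdist X (f x) (f y) = mdist X x y)"

definition homogeneous_metric :: "'a metric \<Rightarrow> bool" where
  "homogeneous_metric X \<longleftrightarrow>
     (\<forall>x\<in>mspace X. \<forall>y\<in>mspace X. \<exists>f. self_isometry X f \<and> f x = y)"

definition mbounded_of :: "'a metric \<Rightarrow> 'a set \<Rightarrow> bool" where
  "mbounded_of X S \<longleftrightarrow> Metric_space.mbounded (mspace X) (mdist X) S"

text \<open>
  A set bounded in the sense of \<^const>\<open>mbounded_of\<close> is in particular a subset of the space.
\<close>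

definition one_ended :: "'a metric \<Rightarrow> bool" where
  "one_ended Y \<longleftrightarrow>
     (\<forall>B. mbounded_of Y B \<longrightarrow>
        (\<exists>!C. C \<in> connected_components_of (subtopology (mtopology_of Y) (mspace Y - B)) \<and>
              \<not> mbounded_of Y C))"

definition two_components :: "'a topology \<Rightarrow> bool" where
  "two_components T \<longleftrightarrow>
     (\<exists>C\<in>connected_components_of T. \<exists>D\<in>connected_components_of T. C \<noteq> D)"

text \<open>
  The two notions of cut-point are meant for connected and locally connected spaces; asymptotic
  cones of geodesic spaces are geodesic and hence have both properties.
\<close>

definition global_cut_point :: "'a metric \<Rightarrow> 'a \<Rightarrow> bool" where
  "global_cut_point Y x \<longleftrightarrow>
     x \<in> mspace Y \<and> two_components (subtopology (mtopology_of Y) (mspace Y - {x}))"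

definition local_cut_point :: "'a metric \<Rightarrow> 'a \<Rightarrow> bool" where
  "local_cut_point Y x \<longleftrightarrow>
     (\<exists>U. openin (mtopology_of Y) U \<and> connectedin (mtopology_of Y) U \<and> x \<in> U \<and>
          two_components (subtopology (mtopology_of Y) (U - {x})))"


section \<open>Asymptotic cones\<close>

text \<open>
  An ultrafilter is represented by a filter; \<open>\<omega>(A) = 1\<close> reads \<open>eventually (\<lambda>n. n \<in> A) \<omega>\<close>, and
  the limit of a real sequence along \<open>\<omega>\<close> is convergence along the filter.  An \<open>\<omega>\<close>-divergent
  sequence exists only if \<open>\<omega>\<close> is non-principal, so non-principality need not be demanded.
\<close>

definition is_ultrafilter :: "'a filter \<Rightarrow> bool" where
  "is_ultrafilter \<omega> \<longleftrightarrow>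
     \<omega> \<noteq> bot \<and> (\<forall>P. eventually P \<omega> \<or> eventually (\<lambda>n. \<not> P n) \<omega>)"

definition cone_data :: "'a metric \<Rightarrow> nat filter \<Rightarrow> (nat \<Rightarrow> 'a) \<Rightarrow> (nat \<Rightarrow> real) \<Rightarrow> bool" where
  "cone_data X \<omega> e r \<longleftrightarrow>
     is_ultrafilter \<omega> \<and> (\<forall>n. e n \<in> mspace X) \<and> (\<forall>n. 0 < r n) \<and>
     (\<forall>K. eventually (\<lambda>n. K < r n) \<omega>)"

definition cone_seqs :: "'a metric \<Rightarrow> nat filter \<Rightarrow> (nat \<Rightarrow> 'a) \<Rightarrow> (nat \<Rightarrow> real) \<Rightarrow> (nat \<Rightarrow> 'a) set" where
  "cone_seqs X \<omega> e r =
     {x. (\<forall>n. x n \<in> mspace X) \<and> (\<exists>l. ((\<lambda>n. mdist X (x n) (e n) / r n) \<longlongrightarrow> l) \<omega>)}"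

definition cone_rel ::
    "'a metric \<Rightarrow> nat filter \<Rightarrow> (nat \<Rightarrow> 'a) \<Rightarrow> (nat \<Rightarrow> real) \<Rightarrow> ((nat \<Rightarrow> 'a) \<times> (nat \<Rightarrow> 'a)) set" where
  "cone_rel X \<omega> e r =
     {(x, y). x \<in> cone_seqs X \<omega> e r \<and> y \<in> cone_seqs X \<omega> e r \<and>
              ((\<lambda>n. mdist X (x n) (y n) / r n) \<longlongrightarrow> 0) \<omega>}"

definition cone_points ::
    "'a metric \<Rightarrow> nat filter \<Rightarrow> (nat \<Rightarrow> 'a) \<Rightarrow> (nat \<Rightarrow> real) \<Rightarrow> (nat \<Rightarrow> 'a) set set" where
  "cone_points X \<omega> e r = cone_seqs X \<omega> e r // cone_rel X \<omega> e r"

text \<open>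
  The value 0 off the carrier is there because \<^const>\<open>Metric_space\<close> requires nonnegativity and
  symmetry on the whole type.
\<close>

definition cone_dist ::
    "'a metric \<Rightarrow> nat filter \<Rightarrow> (nat \<Rightarrow> 'a) \<Rightarrow> (nat \<Rightarrow> real) \<Rightarrow>
     (nat \<Rightarrow> 'a) set \<Rightarrow> (nat \<Rightarrow> 'a) set \<Rightarrow> real" where
  "cone_dist X \<omega> e r P Q =
     (if P \<in> cone_points X \<omega> e r \<and> Q \<in> cone_points X \<omega> e r
      then THE l. \<forall>x\<in>P. \<forall>y\<in>Q. ((\<lambda>n. mdist X (x n) (y n) / r n) \<longlongrightarrow> l) \<omega>
      else 0)"

definition asymptotic_cone ::
    "'a metric \<Rightarrow> nat filter \<Rightarrow> (nat \<Rightarrow> 'a) \<Rightarrow> (nat \<Rightarrow> real) \<Rightarrow> (nat \<Rightarrow> 'a) set metric" where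
  "asymptotic_cone X \<omega> e r = metric (cone_points X \<omega> e r, cone_dist X \<omega> e r)"

definition wide :: "'a metric \<Rightarrow> bool" where
  "wide X \<longleftrightarrow>
     (\<forall>\<omega> e r. cone_data X \<omega> e r \<longrightarrow> \<not> (\<exists>p. global_cut_point (asymptotic_cone X \<omega> e r) p))"


section \<open>The asymptotic cone is well defined\<close>

lemma ultrafilter_bounded_convergent:
  fixes f :: "'a \<Rightarrow> real"
  assumes U: "is_ultrafilter \<omega>" and bd: "eventually (\<lambda>n. \<bar>f n\<bar> \<le> K) \<omega>"
  shows "\<exists>l. (f \<longlongrightarrow> l) \<omega>"
proof -
  let ?F = "filtermap f \<omega>"
  have nb: "?F \<noteq> bot" using U by (simp add: is_ultrafilter_def filtermap_bot_iff)
  have ev: "eventually (\<lambda>x. x \<in> {-K..K}) ?F"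
    using bd by (auto simp: eventually_filtermap elim!: eventually_mono)
  have "compact {-K..K}" by simp
  then obtain l where l: "inf (nhds l) ?F \<noteq> bot"
    using nb ev unfolding compact_filter by blast
  have "(f \<longlongrightarrow> l) \<omega>"
  proof (rule topological_tendstoI)
    fix S assume S: "open S" "l \<in> S"
    show "eventually (\<lambda>n. f n \<in> S) \<omega>"
    proof (rule ccontr)
      assume "\<not> eventually (\<lambda>n. f n \<in> S) \<omega>"
      then have "eventually (\<lambda>n. f n \<notin> S) \<omega>" using U by (auto simp: is_ultrafilter_def)
      then have "eventually (\<lambda>x. x \<notin> S) ?F" by (simp add: eventually_filtermap)
      moreover have "eventually (\<lambda>x. x \<in> S) (nhds l)" using S by (rule eventually_nhds_in_open)
      ultimately have "eventually (\<lambda>x. False) (inf (nhds l) ?F)"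
        unfolding eventually_inf by blast
      then show False using l by (simp add: trivial_limit_def)
    qed
  qed
  then show ?thesis ..
qed

context
  fixes X :: "'a metric" and \<omega> :: "nat filter" and e :: "nat \<Rightarrow> 'a" and r :: "nat \<Rightarrow> real"
  assumes D: "cone_data X \<omega> e r"
begin

lemma cone_rescaled_triangle:
  assumes "x \<in> cone_seqs X \<omega> e r" "y \<in> cone_seqs X \<omega> e r" "z \<in> cone_seqs X \<omega> e r"
  shows "mdist X (x n) (z n) / r n \<le> mdist X (x n) (y n) / r n + mdist X (y n) (z n) / r n"
proof -
  have "mdist X (x n) (z n) \<le> mdist X (x n) (y n) + mdist X (y n) (z n)"
    using assms by (intro mdist_triangle) (auto simp: cone_seqs_def)
  moreover have "0 < r n" using D by (simp add: cone_data_def)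
  ultimately show ?thesis by (simp add: divide_right_mono flip: add_divide_distrib)
qed

lemma cone_nontrivial: "\<omega> \<noteq> bot"
  using D by (simp add: cone_data_def is_ultrafilter_def)

lemma cone_base_in_seqs: "e \<in> cone_seqs X \<omega> e r"
proof -
  have e: "e n \<in> mspace X" for n using D by (simp add: cone_data_def)
  then have e0: "mdist X (e n) (e n) = 0" for n by simp
  show ?thesis using e by (auto simp: cone_seqs_def e0 intro!: exI[of _ 0])
qed

lemma cone_limit_exists:
  assumes x: "x \<in> cone_seqs X \<omega> e r" and y: "y \<in> cone_seqs X \<omega> e r"
  shows "\<exists>l. ((\<lambda>n. mdist X (x n) (y n) / r n) \<longlongrightarrow> l) \<omega>"
proof -
  obtain a where a: "((\<lambda>n. mdist X (x n) (e n) / r n) \<longlongrightarrow> a) \<omega>"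
    using x by (auto simp: cone_seqs_def)
  obtain b where b: "((\<lambda>n. mdist X (y n) (e n) / r n) \<longlongrightarrow> b) \<omega>"
    using y by (auto simp: cone_seqs_def)
  have rp: "0 < r n" for n using D by (simp add: cone_data_def)
  have "eventually (\<lambda>n. mdist X (x n) (e n) / r n < a + 1) \<omega>"
    using a by (rule order_tendstoD) simp
  moreover have "eventually (\<lambda>n. mdist X (y n) (e n) / r n < b + 1) \<omega>"
    using b by (rule order_tendstoD) simp
  ultimately have "eventually (\<lambda>n. \<bar>mdist X (x n) (y n) / r n\<bar> \<le> a + b + 2) \<omega>"
  proof eventually_elim
    case (elim n)
    have "mdist X (x n) (y n) / r n \<le> mdist X (x n) (e n) / r n + mdist X (e n) (y n) / r n"
      by (rule cone_rescaled_triangle[OF x cone_base_in_seqs y])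
    moreover have "0 \<le> mdist X (x n) (y n) / r n" using rp[of n] by simp
    ultimately show ?case using elim by (simp add: mdist_commute)
  qed
  then show ?thesis
    using D by (intro ultrafilter_bounded_convergent) (auto simp: cone_data_def)
qed

lemma cone_limit_triangle:
  assumes "x \<in> cone_seqs X \<omega> e r" "y \<in> cone_seqs X \<omega> e r" "z \<in> cone_seqs X \<omega> e r"
    and "((\<lambda>n. mdist X (x n) (y n) / r n) \<longlongrightarrow> a) \<omega>"
    and "((\<lambda>n. mdist X (y n) (z n) / r n) \<longlongrightarrow> b) \<omega>"
    and "((\<lambda>n. mdist X (x n) (z n) / r n) \<longlongrightarrow> c) \<omega>"
  shows "c \<le> a + b"
  using tendsto_le[OF cone_nontrivial tendsto_add[OF assms(4,5)] assms(6)]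
    cone_rescaled_triangle[OF assms(1-3)] by simp

lemma cone_limit_nonneg:
  assumes "((\<lambda>n. mdist X (x n) (y n) / r n) \<longlongrightarrow> a) \<omega>"
  shows "0 \<le> a"
proof (rule tendsto_lowerbound[OF assms _ cone_nontrivial])
  have "0 < r n" for n using D by (simp add: cone_data_def)
  then show "eventually (\<lambda>n. 0 \<le> mdist X (x n) (y n) / r n) \<omega>"
    by (simp add: less_imp_le)
qed

lemma equiv_cone_rel: "equiv (cone_seqs X \<omega> e r) (cone_rel X \<omega> e r)"
proof (rule equivI)
  show "cone_rel X \<omega> e r \<subseteq> cone_seqs X \<omega> e r \<times> cone_seqs X \<omega> e r"
    by (auto simp: cone_rel_def)
  show "refl_on (cone_seqs X \<omega> e r) (cone_rel X \<omega> e r)"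
  proof (rule refl_onI)
    fix x assume x: "x \<in> cone_seqs X \<omega> e r"
    then have x0: "mdist X (x n) (x n) = 0" for n by (simp add: cone_seqs_def)
    show "(x, x) \<in> cone_rel X \<omega> e r" using x by (simp add: cone_rel_def x0)
  qed
  show "sym (cone_rel X \<omega> e r)"
    by (rule symI) (auto simp: cone_rel_def mdist_commute)
  show "trans (cone_rel X \<omega> e r)"
  proof (rule transI)
    fix x y z assume "(x, y) \<in> cone_rel X \<omega> e r" "(y, z) \<in> cone_rel X \<omega> e r"
    then have s: "x \<in> cone_seqs X \<omega> e r" "y \<in> cone_seqs X \<omega> e r" "z \<in> cone_seqs X \<omega> e r"
      and xy: "((\<lambda>n. mdist X (x n) (y n) / r n) \<longlongrightarrow> 0) \<omega>"
      and yz: "((\<lambda>n. mdist X (y n) (z n) / r n) \<longlongrightarrow> 0) \<omega>"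
      by (auto simp: cone_rel_def)
    obtain c where c: "((\<lambda>n. mdist X (x n) (z n) / r n) \<longlongrightarrow> c) \<omega>"
      using cone_limit_exists s by blast
    have "c = 0"
      using cone_limit_triangle[OF s xy yz c] cone_limit_nonneg[OF c] by simp
    then show "(x, z) \<in> cone_rel X \<omega> e r" using s c by (simp add: cone_rel_def)
  qed
qed

lemma cone_points_seqs:
  assumes "P \<in> cone_points X \<omega> e r" "x \<in> P"
  shows "x \<in> cone_seqs X \<omega> e r"
  using in_quotient_imp_subset[OF equiv_cone_rel] assms by (auto simp: cone_points_def)

lemma cone_points_nonempty:
  assumes "P \<in> cone_points X \<omega> e r"
  obtains x where "x \<in> P"
  using assms equiv_cone_rel by (metis cone_points_def equiv_class_self quotientE)

lemma cone_points_related: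
  assumes "P \<in> cone_points X \<omega> e r" "x \<in> P" "x' \<in> P"
  shows "((\<lambda>n. mdist X (x n) (x' n) / r n) \<longlongrightarrow> 0) \<omega>"
proof -
  have "(x, x') \<in> cone_rel X \<omega> e r"
    using assms quotient_eq_iff[OF equiv_cone_rel] by (auto simp: cone_points_def)
  then show ?thesis by (simp add: cone_rel_def)
qed

lemma cone_dist_tendsto:
  assumes P: "P \<in> cone_points X \<omega> e r" and Q: "Q \<in> cone_points X \<omega> e r"
    and x: "x \<in> P" and y: "y \<in> Q"
  shows "((\<lambda>n. mdist X (x n) (y n) / r n) \<longlongrightarrow> cone_dist X \<omega> e r P Q) \<omega>"
proof -
  obtain l where l: "((\<lambda>n. mdist X (x n) (y n) / r n) \<longlongrightarrow> l) \<omega>"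
    using cone_limit_exists cone_points_seqs P Q x y by blast
  have all: "((\<lambda>n. mdist X (x' n) (y' n) / r n) \<longlongrightarrow> l) \<omega>" if "x' \<in> P" "y' \<in> Q" for x' y'
  proof -
    have s: "x \<in> cone_seqs X \<omega> e r" "x' \<in> cone_seqs X \<omega> e r"
      "y \<in> cone_seqs X \<omega> e r" "y' \<in> cone_seqs X \<omega> e r"
      using cone_points_seqs P Q x y that by blast+
    obtain l' where l': "((\<lambda>n. mdist X (x' n) (y' n) / r n) \<longlongrightarrow> l') \<omega>"
      using cone_limit_exists s by blast
    obtain m where m: "((\<lambda>n. mdist X (x n) (y' n) / r n) \<longlongrightarrow> m) \<omega>"
      using cone_limit_exists s by blast
    note xx = cone_points_related[OF P x that(1)] cone_points_related[OF P that(1) x]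
    note yy = cone_points_related[OF Q y that(2)] cone_points_related[OF Q that(2) y]
    have "m \<le> l" using cone_limit_triangle[OF s(1,3,4) l yy(1) m] by simp
    moreover have "l \<le> m" using cone_limit_triangle[OF s(1,4,3) m yy(2) l] by simp
    moreover have "m \<le> l'" using cone_limit_triangle[OF s(1,2,4) xx(1) l' m] by simp
    moreover have "l' \<le> m" using cone_limit_triangle[OF s(2,1,4) xx(2) m l'] by simp
    ultimately show ?thesis using l' by simp
  qed
  have "(THE l. \<forall>x\<in>P. \<forall>y\<in>Q. ((\<lambda>n. mdist X (x n) (y n) / r n) \<longlongrightarrow> l) \<omega>) = l"
    using all x y tendsto_unique[OF cone_nontrivial] l by (intro the_equality) blast+
  then show ?thesis using l P Q by (simp add: cone_dist_def)
qed

lemma Metric_space_cone: "Metric_space (cone_points X \<omega> e r) (cone_dist X \<omega> e r)"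
proof
  let ?M = "cone_points X \<omega> e r" and ?d = "cone_dist X \<omega> e r"
  note nt = cone_nontrivial
  fix P Q
  show "0 \<le> ?d P Q"
  proof (cases "P \<in> ?M \<and> Q \<in> ?M")
    case True
    then obtain x y where "x \<in> P" "y \<in> Q" by (meson cone_points_nonempty)
    then show ?thesis using cone_limit_nonneg cone_dist_tendsto True by blast
  qed (auto simp: cone_dist_def)
  show "?d P Q = ?d Q P"
  proof (cases "P \<in> ?M \<and> Q \<in> ?M")
    case True
    then obtain x y where "x \<in> P" "y \<in> Q" by (meson cone_points_nonempty)
    then have "((\<lambda>n. mdist X (x n) (y n) / r n) \<longlongrightarrow> ?d P Q) \<omega>"
      "((\<lambda>n. mdist X (y n) (x n) / r n) \<longlongrightarrow> ?d Q P) \<omega>"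
      using cone_dist_tendsto True by blast+
    then show ?thesis using tendsto_unique[OF nt] by (simp add: mdist_commute)
  qed (auto simp: cone_dist_def)
next
  let ?M = "cone_points X \<omega> e r" and ?d = "cone_dist X \<omega> e r"
  note nt = cone_nontrivial
  fix P Q assume P: "P \<in> ?M" and Q: "Q \<in> ?M"
  obtain x y where xy: "x \<in> P" "y \<in> Q" using P Q by (meson cone_points_nonempty)
  note lim = cone_dist_tendsto[OF P Q xy]
  show "?d P Q = 0 \<longleftrightarrow> P = Q"
  proof
    assume "?d P Q = 0"
    then have "(x, y) \<in> cone_rel X \<omega> e r"
      using lim cone_points_seqs P Q xy by (auto simp: cone_rel_def)
    then show "P = Q"
      using quotient_eqI[OF equiv_cone_rel] P Q xy unfolding cone_points_def by blast
  next
    assume "P = Q"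
    then show "?d P Q = 0"
      using cone_points_related[OF P] xy lim tendsto_unique[OF nt] by blast
  qed
next
  let ?M = "cone_points X \<omega> e r" and ?d = "cone_dist X \<omega> e r"
  fix P Q R assume M: "P \<in> ?M" "Q \<in> ?M" "R \<in> ?M"
  then obtain x y z where "x \<in> P" "y \<in> Q" "z \<in> R" by (meson cone_points_nonempty)
  then show "?d P R \<le> ?d P Q + ?d Q R"
    using cone_limit_triangle[of x y z] cone_points_seqs cone_dist_tendsto M by blast
qed

lemma mspace_asymptotic_cone: "mspace (asymptotic_cone X \<omega> e r) = cone_points X \<omega> e r"
  and mdist_asymptotic_cone: "mdist (asymptotic_cone X \<omega> e r) = cone_dist X \<omega> e r"
  using Metric_space_cone
  by (simp_all add: asymptotic_cone_def Metric_space.mspace_metric Metric_space.mdist_metric)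

end

end

theory Submission
  imports Defs
begin

text \<open>
  In a geodesic space, two points \<open>a\<close> and \<open>b\<close> other than \<open>p\<close> lie in the same component of the complement of
  \<open>p\<close> exactly if a finite chain of jumps \<open>x \<mapsto> y\<close> with \<open>d x y + t \<le> d x p\<close>, for some \<open>t > 0\<close>,
  leads from \<open>a\<close> to \<open>b\<close>.  Such chains of bounded length pass from \<open>X\<close> to its cones and back, up to
  an arbitrarily small loss in \<open>t\<close>.  So if some cone has, for every \<open>n\<close>, two points at the same
  distance \<open>s\<close> from \<open>p\<close> that no chain of \<open>n\<close> jumps with \<open>t = s/n\<close> connects, then such
  configurations occur in \<open>X\<close> at arbitrarily large scales, and a diagonal choice of scales gives a
  cone with a global cut-point.  A local cut-point provides these pairs with \<open>s\<close> tending to 0, and two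
  ends of a cone provide them with \<open>s\<close> tending to infinity.  Conversely, in a homogeneous geodesic
  space all components of the complement of a global cut-point are unbounded, so the complement has at
  least two ends.
\<close>

section \<open>Components in geodesic spaces\<close>

abbreviation conn_in :: "'a metric \<Rightarrow> 'a set \<Rightarrow> 'a \<Rightarrow> 'a \<Rightarrow> bool" where
  "conn_in M S \<equiv> connected_component_of (subtopology (mtopology_of M) S)"

lemma mdist_self: "x \<in> mspace M \<Longrightarrow> mdist M x x = 0"
  by simp

lemma mdist_pos:
  assumes "x \<in> mspace M" "y \<in> mspace M" "x \<noteq> y"
  shows "0 < mdist M x y"
  using assms mdist_zero[of x M y] mdist_nonneg[of M x y] by (simp add: less_le)

lemma two_components_iff: "two_components T \<longleftrightarrow> \<not> connected_space T"
  by (auto simp: two_components_def connected_space_iff_components_eq)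

lemma mbounded_of_iff:
  assumes "p \<in> mspace M"
  shows "mbounded_of M S \<longleftrightarrow> S \<subseteq> mspace M \<and> (\<exists>K. \<forall>x\<in>S. mdist M x p \<le> K)"
proof -
  interpret Metric_space "mspace M" "mdist M" by simp
  show ?thesis
  proof
    assume "mbounded_of M S"
    then have "S = {} \<or> S \<subseteq> mspace M \<and> (\<exists>y B. y \<in> mspace M \<and> (\<forall>x\<in>S. mdist M y x \<le> B))"
      by (auto simp: mbounded_of_def mbounded)
    moreover have "\<exists>K. \<forall>x\<in>S. mdist M x p \<le> K"
      if S: "S \<subseteq> mspace M" and y: "y \<in> mspace M" and B: "\<forall>x\<in>S. mdist M y x \<le> B" for y B
    proof (intro exI ballI)
      fix x assume x: "x \<in> S"
      then show "mdist M x p \<le> B + mdist M y p"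
        using mdist_triangle[of x M y p] S y B assms by (force simp: mdist_commute)
    qed
    ultimately show "S \<subseteq> mspace M \<and> (\<exists>K. \<forall>x\<in>S. mdist M x p \<le> K)" by auto
  next
    assume "S \<subseteq> mspace M \<and> (\<exists>K. \<forall>x\<in>S. mdist M x p \<le> K)"
    then show "mbounded_of M S"
      using assms unfolding mbounded_of_def mbounded by (metis mdist_commute subsetD)
  qed
qed

text \<open>Such a map is 1-Lipschitz, hence continuous. \<open>T\<close> is any connected set
  because both geodesic segments and rays are treated.\<close>

lemma connectedin_isometric_image:
  fixes \<rho> :: "real \<Rightarrow> 'a"
  assumes T: "connected T" and \<rho>: "\<rho> ` T \<subseteq> mspace M"
    and d: "\<And>s t. s \<in> T \<Longrightarrow> t \<in> T \<Longrightarrow> mdist M (\<rho> s) (\<rho> t) = \<bar>s - t\<bar>"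
  shows "connectedin (mtopology_of M) (\<rho> ` T)"
proof -
  have "Lipschitz_continuous_map (submetric euclidean_metric T) M \<rho>"
    unfolding Lipschitz_continuous_map_def
    using \<rho> d by (auto intro!: exI[of _ 1] simp: dist_real_def)
  then have "continuous_map (mtopology_of (submetric euclidean_metric T)) (mtopology_of M) \<rho>"
    by (rule Lipschitz_continuous_imp_continuous_map)
  then have "continuous_map (subtopology euclidean T) (mtopology_of M) \<rho>"
    by (simp add: mtopology_of_submetric)
  then show ?thesis
    by (rule connectedin_continuous_map_image) (simp add: connectedin_subtopology T)
qed

text \<open>Every point of a geodesic satisfies equality in the triangle inequality, so the
  condition on \<open>S\<close> can be checked without naming a geodesic.\<close>

lemma geodesic_conn_in:
  assumes M: "geodesic_metric M" and x: "x \<in> mspace M" and y: "y \<in> mspace M"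
    and S: "\<And>w. w \<in> mspace M \<Longrightarrow> mdist M x w + mdist M w y = mdist M x y \<Longrightarrow> w \<in> S"
  shows "conn_in M S x y"
proof -
  obtain \<gamma> :: "real \<Rightarrow> 'a" where g: "\<gamma> ` {0..mdist M x y} \<subseteq> mspace M" "\<gamma> 0 = x"
    "\<gamma> (mdist M x y) = y"
    "\<And>s t. s \<in> {0..mdist M x y} \<Longrightarrow> t \<in> {0..mdist M x y} \<Longrightarrow> mdist M (\<gamma> s) (\<gamma> t) = \<bar>s - t\<bar>"
    using M x y unfolding geodesic_metric_def by metis
  have c: "connectedin (mtopology_of M) (\<gamma> ` {0..mdist M x y})"
    by (rule connectedin_isometric_image) (use g in auto)
  have "\<gamma> ` {0..mdist M x y} \<subseteq> S"
  proof clarify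
    fix t assume t: "t \<in> {0..mdist M x y}"
    have "mdist M (\<gamma> 0) (\<gamma> t) = t" "mdist M (\<gamma> t) (\<gamma> (mdist M x y)) = mdist M x y - t"
      using g(4)[of 0 t] g(4)[of t "mdist M x y"] t by auto
    moreover have "\<gamma> t \<in> mspace M" using g(1) t by blast
    ultimately show "\<gamma> t \<in> S" using S[of "\<gamma> t"] g(2,3) by simp
  qed
  moreover have "x \<in> \<gamma> ` {0..mdist M x y}" "y \<in> \<gamma> ` {0..mdist M x y}"
    using g(2,3) by (metis atLeastAtMost_iff image_eqI mdist_nonneg order_refl)+
  ultimately show ?thesis
    using c unfolding connected_component_of_def connectedin_subtopology by blast
qed

lemma connected_space_geodesic:
  assumes "geodesic_metric M" shows "connected_space (mtopology_of M)"
  using geodesic_conn_in[OF assms, where S = "mspace M"]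
  by (simp add: connected_space_iff_connected_component subtopology_superset)

lemma connectedin_mdist_ivt:
  assumes C: "connectedin (mtopology_of M) C" and p: "p \<in> mspace M"
    and x: "x \<in> C" "mdist M x p \<le> s" and y: "y \<in> C" "s \<le> mdist M y p"
  shows "\<exists>z\<in>C. mdist M z p = s"
proof -
  have "connected (mdist M p ` C)"
    using connectedin_continuous_map_image[OF continuous_on_mdist[OF p] C] by simp
  moreover have "mdist M p x \<in> mdist M p ` C" "mdist M p y \<in> mdist M p ` C"
    using x y by auto
  moreover have "mdist M p x \<le> s" "s \<le> mdist M p y"
    using x y by (auto simp: mdist_commute)
  ultimately have "s \<in> mdist M p ` C"
    unfolding connected_iff_interval by blast
  then show ?thesis by (auto simp: mdist_commute)
qed

lemma openin_mtopology_of: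
  "openin (mtopology_of M) U \<longleftrightarrow>
     U \<subseteq> mspace M \<and> (\<forall>x\<in>U. \<exists>e>0. \<forall>y\<in>mspace M. mdist M x y < e \<longrightarrow> y \<in> U)"
proof -
  interpret Metric_space "mspace M" "mdist M" by simp
  have "mball x e \<subseteq> U \<longleftrightarrow> (\<forall>y\<in>mspace M. mdist M x y < e \<longrightarrow> y \<in> U)" if "x \<in> mspace M" for x e
    using that by auto
  then show ?thesis
    unfolding mtopology_of_def openin_mtopology by (meson in_mono)
qed

text \<open>Every component of \<open>U - {p}\<close> accumulates at \<open>p\<close>: otherwise it
  and its complement in \<open>U\<close> would both be open, against the connectedness of
  \<open>U\<close>.\<close>

lemma local_cut_component_near:
  assumes M: "geodesic_metric M" and U: "openin (mtopology_of M) U"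
    "connectedin (mtopology_of M) U" and p: "p \<in> U" and a: "a \<in> U - {p}" and e: "0 < e"
  shows "\<exists>c. conn_in M (U - {p}) a c \<and> mdist M c p < e"
proof (rule ccontr)
  assume "\<not> ?thesis"
  then have far: "\<And>c. conn_in M (U - {p}) a c \<Longrightarrow> e \<le> mdist M c p" by force
  define C where "C = {c. conn_in M (U - {p}) a c}"
  have UM: "U \<subseteq> mspace M" using openin_subset[OF U(1)] by simp
  have CU: "C \<subseteq> U - {p}"
    using connected_component_of_subset_topspace[of "subtopology (mtopology_of M) (U - {p})" a]
    by (auto simp: C_def)
  have aC: "a \<in> C" using a UM by (auto simp: C_def connected_component_of_refl)
  \<comment> \<open>A geodesic from \<open>x\<close> that is shorter than both
    \<open>\<delta>\<close> and the distance to \<open>p\<close> stays in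
    \<open>U - {p}\<close>.\<close>
  have nbhd: "\<exists>\<delta>>0. \<forall>y\<in>mspace M. mdist M x y < \<delta> \<longrightarrow> conn_in M (U - {p}) x y"
    if x: "x \<in> U - {p}" for x
  proof -
    obtain \<delta> where d: "\<delta> > 0" "\<forall>y\<in>mspace M. mdist M x y < \<delta> \<longrightarrow> y \<in> U"
      using U x unfolding openin_mtopology_of by blast
    show ?thesis
    proof (intro exI[of _ "min \<delta> (mdist M x p)"] conjI ballI impI)
      show "0 < min \<delta> (mdist M x p)"
        using d x UM p mdist_pos[of x M p] by auto
      fix y assume y: "y \<in> mspace M" "mdist M x y < min \<delta> (mdist M x p)"
      show "conn_in M (U - {p}) x y"
      proof (rule geodesic_conn_in[OF M])
        fix w assume w: "w \<in> mspace M" "mdist M x w + mdist M w y = mdist M x y"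
        then have "mdist M x w < min \<delta> (mdist M x p)"
          using y mdist_nonneg[of M w y] by linarith
        then show "w \<in> U - {p}" using d w by auto
      qed (use x y UM in auto)
    qed
  qed
  have C: "openin (mtopology_of M) C"
    unfolding openin_mtopology_of
  proof (intro conjI ballI)
    show "C \<subseteq> mspace M" using CU UM by blast
    fix x assume x: "x \<in> C"
    then show "\<exists>e>0. \<forall>y\<in>mspace M. mdist M x y < e \<longrightarrow> y \<in> C"
      using nbhd[of x] CU unfolding C_def by (blast intro: connected_component_of_trans)
  qed
  have UC: "openin (mtopology_of M) (U - C)"
    unfolding openin_mtopology_of
  proof (intro conjI ballI)
    show "U - C \<subseteq> mspace M" using UM by blast
    fix x assume x: "x \<in> U - C"
    show "\<exists>e>0. \<forall>y\<in>mspace M. mdist M x y < e \<longrightarrow> y \<in> U - C"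
    \<comment> \<open>Only at \<open>p\<close> is the assumption \<open>far\<close> used: it
      provides a ball free of \<open>C\<close>.\<close>
    proof (cases "x = p")
      case True
      obtain \<delta> where d: "\<delta> > 0" "\<forall>y\<in>mspace M. mdist M p y < \<delta> \<longrightarrow> y \<in> U"
        using U p unfolding openin_mtopology_of by blast
      then show ?thesis
        using far True e unfolding C_def
        by (intro exI[of _ "min \<delta> e"]) (force simp: mdist_commute)
    next
      case False
      then obtain \<delta> where d: "\<delta> > 0" "\<forall>y\<in>mspace M. mdist M x y < \<delta> \<longrightarrow> conn_in M (U - {p}) x y"
        using nbhd[of x] x by blast
      have "y \<in> U - C" if "y \<in> mspace M" "mdist M x y < \<delta>" for y
      proof -
        have xy: "conn_in M (U - {p}) x y" using d that by blast
        then have "y \<in> U"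
          using connected_component_in_topspace[OF xy] by auto
        moreover have "y \<notin> C"
        proof
          assume "y \<in> C"
          then have "conn_in M (U - {p}) a y" by (simp add: C_def)
          moreover have "conn_in M (U - {p}) y x" using xy by (simp add: connected_component_of_sym)
          ultimately have "x \<in> C" unfolding C_def by (blast intro: connected_component_of_trans)
          then show False using x by blast
        qed
        ultimately show ?thesis by blast
      qed
      then show ?thesis using d(1) by blast
    qed
  qed
  have "C \<inter> (U - C) \<inter> U = {}" "U \<subseteq> C \<union> (U - C)" by auto
  then show False
    using connectedinD[OF U(2) C UC] aC CU p by blast
qed

section \<open>Chains avoiding a point\<close>

text \<open>
  In a geodesic space a step keeps all geodesics from \<open>x\<close> to \<open>y\<close> at distance at least \<open>t\<close>
  from \<open>p\<close>.  Unlike a bound on the length of the steps, this condition becomes weaker when \<open>t\<close>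
  decreases, so the avoided radius can be sent to 0 in the limit.
\<close>

definition avoiding_step :: "'a metric \<Rightarrow> 'a \<Rightarrow> real \<Rightarrow> 'a \<Rightarrow> 'a \<Rightarrow> bool" where
  "avoiding_step M p t x y \<longleftrightarrow> x \<in> mspace M \<and> y \<in> mspace M \<and> mdist M x y + t \<le> mdist M x p"

lemma avoiding_chain_antimono:
  assumes "(avoiding_step M p t ^^ k) x y" "t' \<le> t"
  shows "(avoiding_step M p t' ^^ k) x y"
  using relpowp_mono[of "avoiding_step M p t" "avoiding_step M p t'"] assms
  by (force simp: avoiding_step_def)

text \<open>A point at distance at least \<open>t\<close> from \<open>p\<close> may jump to itself,
  so idle jumps can be put in front of the chain. The length of a chain thus acts as an upper bound
  only.\<close>

lemma avoiding_chain_pad: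
  assumes "(avoiding_step M p t ^^ k) x y" "x \<in> mspace M" "t \<le> mdist M x p" "k \<le> n"
  shows "(avoiding_step M p t ^^ n) x y"
proof -
  have "(avoiding_step M p t ^^ (n - k)) x x"
  proof (induction "n - k" arbitrary: n)
    case (Suc m)
    have "avoiding_step M p t x x" using assms by (simp add: avoiding_step_def mdist_self)
    moreover have "(avoiding_step M p t ^^ m) x x"
      using Suc.hyps(1)[of "k + m"] by simp
    ultimately show ?case using Suc.hyps(2)[symmetric] by (auto intro: relpowp_Suc_I2)
  qed simp
  then show ?thesis
    using relpowp_trans[OF _ assms(1)] assms(4) by fastforce
qed

text \<open>A geodesic between the ends of a jump keeps distance at least \<open>t\<close> from
  \<open>p\<close>, and a jump at most doubles the distance to \<open>p\<close>, hence the factor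
  \<open>2 ^ k\<close>. The upper bound serves to stay in a small ball, the lower bound to stay
  outside a bounded set.\<close>

lemma avoiding_chain_conn_in:
  assumes M: "geodesic_metric M" and p: "p \<in> mspace M" and t: "0 \<le> t"
    and "(avoiding_step M p t ^^ k) x y" "x \<in> mspace M" "x \<in> S"
    and "\<And>w. w \<in> mspace M \<Longrightarrow> t \<le> mdist M w p \<Longrightarrow> mdist M w p \<le> 2 ^ k * mdist M x p \<Longrightarrow> w \<in> S"
  shows "conn_in M S x y"
  using assms(4-)
proof (induction k arbitrary: x)
  case 0
  then show ?case by (auto simp: connected_component_of_refl)
next
  case (Suc k)
  obtain z where z: "avoiding_step M p t x z" "(avoiding_step M p t ^^ k) z y"
    using Suc.prems(1) by (rule relpowp_Suc_E2)
  have zM: "z \<in> mspace M" and xz: "mdist M x z + t \<le> mdist M x p"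
    using z by (auto simp: avoiding_step_def)
  have near: "w \<in> S" if w: "w \<in> mspace M" "mdist M x w \<le> mdist M x z" "mdist M w p \<le> 2 * mdist M x p" for w
  proof (rule Suc.prems(4)[OF w(1)])
    show "t \<le> mdist M w p"
      using mdist_triangle[of x M w p] w p Suc.prems(2) xz by linarith
    have "2 * mdist M x p \<le> 2 ^ Suc k * mdist M x p"
      by (simp add: mult_right_mono)
    then show "mdist M w p \<le> 2 ^ Suc k * mdist M x p" using w by linarith
  qed
  have 1: "conn_in M S x z"
  proof (rule geodesic_conn_in[OF M Suc.prems(2) zM])
    fix w assume w: "w \<in> mspace M" "mdist M x w + mdist M w z = mdist M x z"
    have "mdist M x w \<le> mdist M x z" using w mdist_nonneg[of M w z] by linarith
    moreover from this have "mdist M w p \<le> 2 * mdist M x p"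
      using mdist_triangle[of w M x p] mdist_commute[of M w x] w p Suc.prems(2) xz t by linarith
    ultimately show "w \<in> S" using near w by blast
  qed
  have zp: "mdist M z p \<le> 2 * mdist M x p"
    using mdist_triangle[of z M x p] mdist_commute[of M z x] zM p Suc.prems(2) xz t by linarith
  have 2: "conn_in M S z y"
  proof (rule Suc.IH[OF z(2) zM])
    show "z \<in> S" using near zM zp by simp
    fix w assume w: "w \<in> mspace M" "t \<le> mdist M w p" "mdist M w p \<le> 2 ^ k * mdist M z p"
    have "2 ^ k * mdist M z p \<le> 2 ^ Suc k * mdist M x p"
      using zp by simp
    then show "w \<in> S" using Suc.prems(4)[of w] w by linarith
  qed
  show ?case using 1 2 by (rule connected_component_of_trans)
qed

text \<open>The points reachable from \<open>x\<close> for some \<open>t > 0\<close> form a set that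
  is open and closed in the complement of \<open>p\<close>. Since \<open>t\<close> may depend on the
  end point, each further jump may lower it.\<close>

lemma avoiding_chain_exists:
  assumes c: "connected_space (subtopology (mtopology_of M) (mspace M - {p}))"
    and p: "p \<in> mspace M" and x: "x \<in> mspace M - {p}" and y: "y \<in> mspace M - {p}"
  shows "\<exists>t>0. \<exists>k. (avoiding_step M p t ^^ k) x y"
proof -
  define R where "R = {z \<in> mspace M - {p}. \<exists>t>0. \<exists>k. (avoiding_step M p t ^^ k) x z}"
  have pos: "0 < mdist M z p" if "z \<in> mspace M - {p}" for z
    using that p mdist_pos by auto
  \<comment> \<open>One more jump reaches any point nearer to \<open>z\<close> than \<open>p\<close>
    is, once \<open>t\<close> is lowered to the gap between the two distances.\<close>
  have ext: "z' \<in> R" if z: "z \<in> R" "z' \<in> mspace M - {p}" "mdist M z z' < mdist M z p" for z z'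
  proof -
    obtain t k where tk: "t > 0" "(avoiding_step M p t ^^ k) x z" using z(1) unfolding R_def by blast
    define t' where "t' = min t (mdist M z p - mdist M z z')"
    have "(avoiding_step M p t' ^^ k) x z"
      by (rule avoiding_chain_antimono[OF tk(2)]) (simp add: t'_def)
    moreover have "avoiding_step M p t' z z'"
      using z by (auto simp: avoiding_step_def t'_def R_def)
    ultimately have "(avoiding_step M p t' ^^ Suc k) x z'" by (rule relpowp_Suc_I)
    moreover have "t' > 0" using tk z by (simp add: t'_def)
    ultimately show ?thesis using z unfolding R_def by blast
  qed
  have xR: "x \<in> R" using x unfolding R_def
    by (auto intro!: exI[of _ 1] exI[of _ "0::nat"])
  have open1: "openin (mtopology_of M) R" unfolding openin_mtopology_of
  proof (intro conjI ballI)
    show "R \<subseteq> mspace M" by (auto simp: R_def)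
    fix z assume z: "z \<in> R"
    then have "0 < mdist M z p" using pos by (auto simp: R_def)
    then show "\<exists>e>0. \<forall>y\<in>mspace M. mdist M z y < e \<longrightarrow> y \<in> R"
      using ext[OF z] by (intro exI[of _ "mdist M z p"]) auto
  qed
  have open2: "openin (mtopology_of M) (mspace M - {p} - R)" unfolding openin_mtopology_of
  proof (intro conjI ballI)
    fix z assume z: "z \<in> mspace M - {p} - R"
    then have zp: "0 < mdist M z p" using pos by auto
    \<comment> \<open>Half the distance makes the jump reversible: \<open>z\<close> is nearer to
      \<open>y\<close> than \<open>p\<close> is, so \<open>y\<close> in \<open>R\<close> would put
      \<open>z\<close> in \<open>R\<close>.\<close>
    show "\<exists>e>0. \<forall>y\<in>mspace M. mdist M z y < e \<longrightarrow> y \<in> mspace M - {p} - R"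
    proof (intro exI[of _ "mdist M z p / 2"] conjI ballI impI)
      fix y assume y: "y \<in> mspace M" "mdist M z y < mdist M z p / 2"
      have "mdist M z p \<le> mdist M z y + mdist M y p"
        using mdist_triangle[of z M y p] z y p by auto
      then have "mdist M y z < mdist M y p" using y mdist_commute[of M y z] by linarith
      then have "y \<notin> R" using ext[of y z] z by blast
      moreover have "y \<noteq> p" using y zp by auto
      ultimately show "y \<in> mspace M - {p} - R" using y by auto
    qed (use zp in simp)
  qed auto
  have "connectedin (mtopology_of M) (mspace M - {p})"
    using c by (auto simp: connectedin_def)
  from connectedinD[OF this open1 open2] have "y \<in> R"
    using xR x y by (auto simp: R_def)
  then show ?thesis by (auto simp: R_def)
qed

section \<open>Sequences and points of an asymptotic cone\<close>

definition cone_class ::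
    "'a metric \<Rightarrow> nat filter \<Rightarrow> (nat \<Rightarrow> 'a) \<Rightarrow> (nat \<Rightarrow> real) \<Rightarrow> (nat \<Rightarrow> 'a) \<Rightarrow> (nat \<Rightarrow> 'a) set" where
  "cone_class X \<omega> e r x = cone_rel X \<omega> e r `` {x}"

context
  fixes X :: "'a metric" and \<omega> :: "nat filter" and e :: "nat \<Rightarrow> 'a" and r :: "nat \<Rightarrow> real"
  assumes D: "cone_data X \<omega> e r"
begin

abbreviation (input) "acone \<equiv> asymptotic_cone X \<omega> e r"

lemma cone_scale_pos: "0 < r n"
  using D by (simp add: cone_data_def)

lemma cone_eventually_not: "\<not> eventually P \<omega> \<Longrightarrow> eventually (\<lambda>n. \<not> P n) \<omega>"
  using D by (auto simp: cone_data_def is_ultrafilter_def)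

lemma cone_class_in: "x \<in> cone_seqs X \<omega> e r \<Longrightarrow> cone_class X \<omega> e r x \<in> mspace acone"
  by (simp add: mspace_asymptotic_cone[OF D] cone_points_def cone_class_def quotientI)

lemma in_cone_class: "x \<in> cone_seqs X \<omega> e r \<Longrightarrow> x \<in> cone_class X \<omega> e r x"
  using equiv_class_self[OF equiv_cone_rel[OF D]] by (simp add: cone_class_def)

lemma cone_rep_in_seqs: "P \<in> mspace acone \<Longrightarrow> x \<in> P \<Longrightarrow> x \<in> cone_seqs X \<omega> e r"
  using cone_points_seqs[OF D] by (simp add: mspace_asymptotic_cone[OF D])

lemma cone_rep_in_space: "P \<in> mspace acone \<Longrightarrow> x \<in> P \<Longrightarrow> x n \<in> mspace X"
  using cone_rep_in_seqs by (auto simp: cone_seqs_def)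

lemma cone_rep_exists: "P \<in> mspace acone \<Longrightarrow> \<exists>x. x \<in> P"
  using cone_points_nonempty[OF D] by (metis mspace_asymptotic_cone[OF D])

lemma cone_mdist_tendsto:
  assumes "P \<in> mspace acone" "Q \<in> mspace acone" "x \<in> P" "y \<in> Q"
  shows "((\<lambda>n. mdist X (x n) (y n) / r n) \<longlongrightarrow> mdist acone P Q) \<omega>"
  using cone_dist_tendsto[OF D] assms
  by (simp add: mspace_asymptotic_cone[OF D] mdist_asymptotic_cone[OF D])

lemma cone_mdist_eqI:
  assumes "P \<in> mspace acone" "Q \<in> mspace acone" "x \<in> P" "y \<in> Q"
    "((\<lambda>n. mdist X (x n) (y n) / r n) \<longlongrightarrow> l) \<omega>"
  shows "mdist acone P Q = l"
  using tendsto_unique[OF cone_nontrivial[OF D] cone_mdist_tendsto] assms by blast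

lemma cone_point_eqI:
  assumes "P \<in> mspace acone" "Q \<in> mspace acone" "x \<in> P" "y \<in> Q"
    "((\<lambda>n. mdist X (x n) (y n) / r n) \<longlongrightarrow> 0) \<omega>"
  shows "P = Q"
  using cone_mdist_eqI[OF assms] assms by simp

text \<open>Bounded real sequences converge along an ultrafilter, so a bound at almost all indices
  suffices, measured from any admissible sequence \<open>c\<close>.\<close>

lemma cone_seqs_boundedI:
  assumes x: "\<And>n. x n \<in> mspace X" and c: "c \<in> cone_seqs X \<omega> e r"
    and bd: "eventually (\<lambda>n. mdist X (x n) (c n) / r n \<le> K) \<omega>"
  shows "x \<in> cone_seqs X \<omega> e r"
proof -
  obtain l where l: "((\<lambda>n. mdist X (c n) (e n) / r n) \<longlongrightarrow> l) \<omega>"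
    using c by (auto simp: cone_seqs_def)
  have "eventually (\<lambda>n. mdist X (c n) (e n) / r n < l + 1) \<omega>"
    using l by (rule order_tendstoD) simp
  with bd have "eventually (\<lambda>n. \<bar>mdist X (x n) (e n) / r n\<bar> \<le> K + l + 1) \<omega>"
  proof eventually_elim
    case (elim n)
    have "mdist X (x n) (e n) \<le> mdist X (x n) (c n) + mdist X (c n) (e n)"
      using x c D by (intro mdist_triangle) (auto simp: cone_seqs_def cone_data_def)
    then have "mdist X (x n) (e n) / r n \<le> mdist X (x n) (c n) / r n + mdist X (c n) (e n) / r n"
      using cone_scale_pos[of n] by (simp add: divide_right_mono flip: add_divide_distrib)
    moreover have "0 \<le> mdist X (x n) (e n) / r n" using cone_scale_pos[of n] by simp
    ultimately show ?case using elim by simp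
  qed
  then have "\<exists>l. ((\<lambda>n. mdist X (x n) (e n) / r n) \<longlongrightarrow> l) \<omega>"
    using D by (intro ultrafilter_bounded_convergent) (auto simp: cone_data_def)
  then show ?thesis using x by (auto simp: cone_seqs_def)
qed

section \<open>Chains in cones\<close>

text \<open>An inequality between limits holds along the sequences only after a strict loss, hence
  \<open>t' < t\<close>. In the opposite direction \<open>t\<close> is kept, since non-strict
  inequalities pass to limits.\<close>

lemma avoiding_step_lift:
  assumes P: "P \<in> mspace acone" "p \<in> P" and Q: "x \<in> Q" and R: "y \<in> R"
    and step: "avoiding_step acone P t Q R" and t': "t' < t"
  shows "eventually (\<lambda>n. avoiding_step X (p n) (t' * r n) (x n) (y n)) \<omega>"
proof -
  have M: "Q \<in> mspace acone" "R \<in> mspace acone" and le: "mdist acone Q R + t \<le> mdist acone Q P"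
    using step by (auto simp: avoiding_step_def)
  have "((\<lambda>n. mdist X (x n) (p n) / r n - mdist X (x n) (y n) / r n) \<longlongrightarrow>
      mdist acone Q P - mdist acone Q R) \<omega>"
    by (intro tendsto_diff cone_mdist_tendsto P Q R M)
  then have "eventually (\<lambda>n. t' < mdist X (x n) (p n) / r n - mdist X (x n) (y n) / r n) \<omega>"
    by (rule order_tendstoD) (use le t' in linarith)
  then show ?thesis
  proof eventually_elim
    case (elim n)
    then have "t' * r n < mdist X (x n) (p n) - mdist X (x n) (y n)"
      using cone_scale_pos[of n] by (simp add: pos_less_divide_eq flip: diff_divide_distrib)
    then show ?case
      using M Q R by (simp add: avoiding_step_def cone_rep_in_space)
  qed
qed

lemma avoiding_step_descend:
  assumes P: "P \<in> mspace acone" "p \<in> P" and Q: "Q \<in> mspace acone" "x \<in> Q"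
    and R: "R \<in> mspace acone" "y \<in> R"
    and step: "eventually (\<lambda>n. avoiding_step X (p n) (t * r n) (x n) (y n)) \<omega>"
  shows "avoiding_step acone P t Q R"
proof -
  have "((\<lambda>n. mdist X (x n) (p n) / r n - mdist X (x n) (y n) / r n) \<longlongrightarrow>
      mdist acone Q P - mdist acone Q R) \<omega>"
    by (intro tendsto_diff cone_mdist_tendsto P Q R)
  moreover have "eventually (\<lambda>n. t \<le> mdist X (x n) (p n) / r n - mdist X (x n) (y n) / r n) \<omega>"
    using step
  proof eventually_elim
    case (elim n)
    then show ?case
      using cone_scale_pos[of n]
      by (simp add: avoiding_step_def pos_le_divide_eq flip: diff_divide_distrib)
  qed
  ultimately have "t \<le> mdist acone Q P - mdist acone Q R"
    by (rule tendsto_lowerbound[OF _ _ cone_nontrivial[OF D]])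
  then show ?thesis using Q R by (simp add: avoiding_step_def)
qed

text \<open>The chain has at least one jump: two representatives of the same point may differ at
  every index, so a chain of length 0 does not lift.\<close>

lemma avoiding_chain_lift:
  assumes P: "P \<in> mspace acone" "p \<in> P" and t': "t' < t"
  shows "(avoiding_step acone P t ^^ Suc k) Q R \<Longrightarrow> x \<in> Q \<Longrightarrow> y \<in> R \<Longrightarrow>
    eventually (\<lambda>n. (avoiding_step X (p n) (t' * r n) ^^ Suc k) (x n) (y n)) \<omega>"
proof (induction k arbitrary: R y)
  case 0
  then show ?case using avoiding_step_lift[OF P _ _ _ t'] by (simp only: relpowp_Suc_0)
next
  case (Suc k)
  obtain S where S: "(avoiding_step acone P t ^^ Suc k) Q S" "avoiding_step acone P t S R"
    using Suc.prems(1) by (rule relpowp_Suc_E)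
  then have "S \<in> mspace acone" by (simp add: avoiding_step_def)
  then obtain z where z: "z \<in> S" using cone_rep_exists by blast
  from Suc.IH[OF S(1) Suc.prems(2) z] avoiding_step_lift[OF P z Suc.prems(3) S(2) t']
  show ?case by eventually_elim (rule relpowp_Suc_I)
qed

text \<open>Intermediate points are chosen index by index. Because \<open>0 \<le> t\<close>, a jump
  from \<open>x n\<close> is no longer than the distance to \<open>p n\<close>, so the chosen points
  stay bounded after rescaling and represent a point of the cone.\<close>

lemma avoiding_chain_descend:
  assumes P: "P \<in> mspace acone" "p \<in> P" and R: "R \<in> mspace acone" "y \<in> R" and t: "0 \<le> t"
  shows "eventually (\<lambda>n. (avoiding_step X (p n) (t * r n) ^^ k) (x n) (y n)) \<omega> \<Longrightarrow>
    Q \<in> mspace acone \<Longrightarrow> x \<in> Q \<Longrightarrow> (avoiding_step acone P t ^^ k) Q R"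
proof (induction k arbitrary: Q x)
  case 0
  have "((\<lambda>n. mdist X (x n) (y n) / r n) \<longlongrightarrow> 0) \<omega>"
  proof (rule tendsto_eventually)
    show "eventually (\<lambda>n. mdist X (x n) (y n) / r n = 0) \<omega>"
      using 0(1)
    proof eventually_elim
      case (elim n)
      then show ?case using mdist_self[OF cone_rep_in_space[OF R]] by simp
    qed
  qed
  then have "Q = R" by (rule cone_point_eqI[OF 0(2) R(1) 0(3) R(2)])
  then show ?case by simp
next
  case (Suc k)
  \<comment> \<open>The default \<open>x n\<close> keeps \<open>z n\<close> in \<open>X\<close>
    where there is no chain; almost all indices have one.\<close>
  define z where "z n = (if \<exists>z. avoiding_step X (p n) (t * r n) (x n) z \<and>
      (avoiding_step X (p n) (t * r n) ^^ k) z (y n)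
    then SOME z. avoiding_step X (p n) (t * r n) (x n) z \<and>
      (avoiding_step X (p n) (t * r n) ^^ k) z (y n) else x n)" for n
  have z1: "eventually (\<lambda>n. avoiding_step X (p n) (t * r n) (x n) (z n) \<and>
      (avoiding_step X (p n) (t * r n) ^^ k) (z n) (y n)) \<omega>"
    using Suc.prems(1)
  proof eventually_elim
    case (elim n)
    then have ex: "\<exists>z. avoiding_step X (p n) (t * r n) (x n) z \<and>
      (avoiding_step X (p n) (t * r n) ^^ k) z (y n)" by (rule relpowp_Suc_D2)
    then show ?case unfolding z_def by (simp only: if_True) (rule someI_ex)
  qed
  have xM: "x n \<in> mspace X" for n using cone_rep_in_space Suc.prems by blast
  have zM: "z n \<in> mspace X" for n
  proof (cases "\<exists>z. avoiding_step X (p n) (t * r n) (x n) z \<and>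
      (avoiding_step X (p n) (t * r n) ^^ k) z (y n)")
    case True
    then have "avoiding_step X (p n) (t * r n) (x n) (z n)"
      using someI_ex[OF True] unfolding z_def by (simp only: if_True)
    then show ?thesis by (simp add: avoiding_step_def)
  next
    case False
    then show ?thesis unfolding z_def by (simp only: if_False xM)
  qed
  have "eventually (\<lambda>n. mdist X (x n) (p n) / r n < mdist acone Q P + 1) \<omega>"
    using cone_mdist_tendsto[OF Suc.prems(2) P(1) Suc.prems(3) P(2)] by (rule order_tendstoD) simp
  with z1 have "eventually (\<lambda>n. mdist X (z n) (x n) / r n \<le> mdist acone Q P + 1) \<omega>"
  proof eventually_elim
    case (elim n)
    have "0 \<le> t * r n" using t cone_scale_pos[of n] by simp
    then have "mdist X (z n) (x n) \<le> mdist X (x n) (p n)"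
      using elim by (simp add: avoiding_step_def mdist_commute)
    then have "mdist X (z n) (x n) / r n \<le> mdist X (x n) (p n) / r n"
      using cone_scale_pos[of n] by (simp add: divide_right_mono)
    then show ?case using elim by linarith
  qed
  then have zs: "z \<in> cone_seqs X \<omega> e r"
    by (rule cone_seqs_boundedI[OF zM cone_rep_in_seqs[OF Suc.prems(2,3)]])
  have "avoiding_step acone P t Q (cone_class X \<omega> e r z)"
    by (rule avoiding_step_descend[OF P Suc.prems(2,3) cone_class_in[OF zs] in_cone_class[OF zs]])
      (use z1 in \<open>auto elim: eventually_mono\<close>)
  moreover have "(avoiding_step acone P t ^^ k) (cone_class X \<omega> e r z) R"
    by (rule Suc.IH[OF _ cone_class_in[OF zs] in_cone_class[OF zs]])
      (use z1 in \<open>auto elim: eventually_mono\<close>)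
  ultimately show ?case by (rule relpowp_Suc_I2)
qed

section \<open>Geodesics and isometries of cones\<close>

text \<open>The condition on \<open>T\<close> says that the rescaled distances from \<open>x\<close>
  to \<open>y\<close> have limit at least \<open>t\<close>, possibly infinite. As \<open>y\<close>
  may run off to infinity, one construction covers segments and rays of the cone.\<close>

lemma cone_geodesic:
  assumes X: "geodesic_metric X" and x: "x \<in> cone_seqs X \<omega> e r" and y: "\<And>n. y n \<in> mspace X"
    and T: "\<And>t. t \<in> T \<Longrightarrow> 0 \<le> t \<and> ((\<lambda>n. min t (mdist X (x n) (y n) / r n)) \<longlongrightarrow> t) \<omega>"
  shows "\<exists>\<rho>. \<rho> ` T \<subseteq> mspace acone \<and> (\<forall>s\<in>T. \<forall>t\<in>T. mdist acone (\<rho> s) (\<rho> t) = \<bar>s - t\<bar>) \<and>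
    (0 \<in> T \<longrightarrow> x \<in> \<rho> 0) \<and>
    (\<forall>t\<in>T. ((\<lambda>n. mdist X (x n) (y n) / r n) \<longlongrightarrow> t) \<omega> \<and> y \<in> cone_seqs X \<omega> e r \<longrightarrow> y \<in> \<rho> t)"
proof -
  define L where "L n = mdist X (x n) (y n)" for n
  have xM: "x n \<in> mspace X" for n using x by (simp add: cone_seqs_def)
  have "\<exists>\<gamma>::real \<Rightarrow> 'a. \<gamma> ` {0..L n} \<subseteq> mspace X \<and> \<gamma> 0 = x n \<and> \<gamma> (L n) = y n \<and>
      (\<forall>s\<in>{0..L n}. \<forall>t\<in>{0..L n}. mdist X (\<gamma> s) (\<gamma> t) = \<bar>s - t\<bar>)" for n
    using X xM y unfolding geodesic_metric_def L_def by blast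
  then obtain \<gamma> :: "nat \<Rightarrow> real \<Rightarrow> 'a" where
    g: "\<And>n. \<gamma> n ` {0..L n} \<subseteq> mspace X" "\<And>n. \<gamma> n 0 = x n" "\<And>n. \<gamma> n (L n) = y n"
    "\<And>n s t. s \<in> {0..L n} \<Longrightarrow> t \<in> {0..L n} \<Longrightarrow> mdist X (\<gamma> n s) (\<gamma> n t) = \<bar>s - t\<bar>"
    by metis
  \<comment> \<open>The point at rescaled time \<open>t\<close> on the geodesic from
    \<open>x n\<close> to \<open>y n\<close>, stopped at \<open>y n\<close> if that comes
    first.\<close>
  define u where "u t n = \<gamma> n (min (t * r n) (L n))" for t n
  have L0: "0 \<le> L n" for n by (simp add: L_def)
  have dom: "min (t * r n) (L n) \<in> {0..L n}" if "t \<in> T" for t n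
    using T[OF that] cone_scale_pos[of n] L0[of n] by simp
  have min_div: "min (t * r n) (L n) / r n = min t (L n / r n)" for t n
    using cone_scale_pos[of n] by (simp add: min_divide_distrib_right)
  have uM: "u t n \<in> mspace X" if "t \<in> T" for t n
    using g(1) dom[OF that] unfolding u_def by blast
  have dist: "mdist X (u s n) (\<gamma> n q) / r n = \<bar>min s (L n / r n) - q / r n\<bar>"
    if "s \<in> T" "q \<in> {0..L n}" for s q n
  proof -
    have "mdist X (u s n) (\<gamma> n q) = \<bar>min (s * r n) (L n) - q\<bar>"
      using g(4)[OF dom[OF that(1)] that(2)] by (simp add: u_def)
    then have "mdist X (u s n) (\<gamma> n q) / r n = \<bar>(min (s * r n) (L n) - q) / r n\<bar>"
      using cone_scale_pos[of n] by simp
    then show ?thesis by (simp add: diff_divide_distrib min_div)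
  qed
  have lim: "((\<lambda>n. min t (L n / r n)) \<longlongrightarrow> t) \<omega>" if "t \<in> T" for t
    using T[OF that] by (simp add: L_def)
  have ux: "((\<lambda>n. mdist X (u t n) (x n) / r n) \<longlongrightarrow> t) \<omega>" if t: "t \<in> T" for t
  proof -
    have "mdist X (u t n) (x n) / r n = \<bar>min t (L n / r n)\<bar>" for n
      using dist[OF t, of 0 n] L0[of n] by (simp add: g(2))
    then show ?thesis using tendsto_rabs[OF lim[OF t]] T[OF t] by simp
  qed
  have us: "u t \<in> cone_seqs X \<omega> e r" if t: "t \<in> T" for t
  proof (rule cone_seqs_boundedI[OF uM[OF t] x])
    have "eventually (\<lambda>n. mdist X (u t n) (x n) / r n < t + 1) \<omega>"
      using ux[OF t] by (rule order_tendstoD) simp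
    then show "eventually (\<lambda>n. mdist X (u t n) (x n) / r n \<le> t + 1) \<omega>"
      by (rule eventually_mono) simp
  qed
  have uu: "((\<lambda>n. mdist X (u s n) (u t n) / r n) \<longlongrightarrow> \<bar>s - t\<bar>) \<omega>" if st: "s \<in> T" "t \<in> T" for s t
  proof -
    have "mdist X (u s n) (u t n) / r n = \<bar>min s (L n / r n) - min t (L n / r n)\<bar>" for n
      using dist[OF st(1) dom[OF st(2)], of n] by (simp only: u_def min_div)
    then show ?thesis using tendsto_rabs[OF tendsto_diff[OF lim[OF st(1)] lim[OF st(2)]]] by simp
  qed
  define \<rho> where "\<rho> t = cone_class X \<omega> e r (u t)" for t
  have \<rho>: "\<rho> t \<in> mspace acone" "u t \<in> \<rho> t" if "t \<in> T" for t
    using us[OF that] by (simp_all add: \<rho>_def cone_class_in in_cone_class)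
  show ?thesis
  proof (intro exI[of _ \<rho>] conjI ballI impI)
    show "\<rho> ` T \<subseteq> mspace acone" using \<rho> by blast
    fix s t assume "s \<in> T" "t \<in> T"
    then show "mdist acone (\<rho> s) (\<rho> t) = \<bar>s - t\<bar>"
      by (intro cone_mdist_eqI[OF \<rho>(1) \<rho>(1) \<rho>(2) \<rho>(2) uu])
  next
    assume "0 \<in> T"
    moreover have "u 0 = x" using L0 by (auto simp: u_def g(2))
    ultimately show "x \<in> \<rho> 0" using \<rho>(2)[of 0] by simp
  next
    fix t assume t: "t \<in> T" and
      a: "((\<lambda>n. mdist X (x n) (y n) / r n) \<longlongrightarrow> t) \<omega> \<and> y \<in> cone_seqs X \<omega> e r"
    have "mdist X (u t n) (y n) / r n = \<bar>min t (L n / r n) - L n / r n\<bar>" for n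
      using dist[OF t, of "L n" n] L0[of n] by (simp add: g(3))
    moreover have "((\<lambda>n. \<bar>min t (L n / r n) - L n / r n\<bar>) \<longlongrightarrow> \<bar>t - t\<bar>) \<omega>"
      using a by (intro tendsto_rabs tendsto_diff lim t) (simp add: L_def)
    ultimately have "((\<lambda>n. mdist X (u t n) (y n) / r n) \<longlongrightarrow> 0) \<omega>" by simp
    then have "\<rho> t = cone_class X \<omega> e r y"
      using a by (intro cone_point_eqI[OF \<rho>(1)[OF t] cone_class_in \<rho>(2)[OF t] in_cone_class]) auto
    then show "y \<in> \<rho> t" using a in_cone_class by simp
  qed
qed

lemma cone_points_eq_if_common: "P \<in> mspace acone \<Longrightarrow> Q \<in> mspace acone \<Longrightarrow> x \<in> P \<Longrightarrow> x \<in> Q \<Longrightarrow> P = Q"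
  by (rule cone_point_eqI[where x = x and y = x]) (simp_all add: mdist_self cone_rep_in_space)

lemma geodesic_cone:
  assumes X: "geodesic_metric X"
  shows "geodesic_metric acone"
  unfolding geodesic_metric_def
proof (intro ballI)
  fix P Q assume PQ: "P \<in> mspace acone" "Q \<in> mspace acone"
  then obtain x y where xy: "x \<in> P" "y \<in> Q" using cone_rep_exists by meson
  let ?D = "mdist acone P Q"
  have lim: "((\<lambda>n. mdist X (x n) (y n) / r n) \<longlongrightarrow> ?D) \<omega>"
    by (rule cone_mdist_tendsto[OF PQ xy])
  have "((\<lambda>n. min t (mdist X (x n) (y n) / r n)) \<longlongrightarrow> t) \<omega>" if "t \<in> {0..?D}" for t
    using tendsto_min[OF tendsto_const[of t] lim] that by simp
  then obtain \<rho> where \<rho>: "\<rho> ` {0..?D} \<subseteq> mspace acone"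
    "\<forall>s\<in>{0..?D}. \<forall>t\<in>{0..?D}. mdist acone (\<rho> s) (\<rho> t) = \<bar>s - t\<bar>" "x \<in> \<rho> 0" "y \<in> \<rho> ?D"
    using cone_geodesic[where y = y, OF X cone_rep_in_seqs[OF PQ(1) xy(1)]
        cone_rep_in_space[OF PQ(2) xy(2)], of "{0..?D}"] lim cone_rep_in_seqs[OF PQ(2) xy(2)]
    by auto
  have "\<rho> 0 \<in> mspace acone" "\<rho> ?D \<in> mspace acone" using \<rho>(1) by auto
  then have "\<rho> 0 = P" "\<rho> ?D = Q" using cone_points_eq_if_common PQ xy \<rho>(3,4) by blast+
  then show "\<exists>\<gamma>. \<gamma> ` {0..?D} \<subseteq> mspace acone \<and> \<gamma> 0 = P \<and> \<gamma> ?D = Q \<and>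
      (\<forall>s\<in>{0..?D}. \<forall>t\<in>{0..?D}. mdist acone (\<gamma> s) (\<gamma> t) = \<bar>s - t\<bar>)"
    using \<rho> by blast
qed

text \<open>Isometries \<open>f n\<close> taking \<open>x n\<close> to \<open>y n\<close> are
  applied index by index. They preserve all limits of distances, and images of admissible sequences
  are admissible because \<open>x\<close> goes to the admissible sequence \<open>y\<close>.\<close>

lemma homogeneous_cone:
  assumes X: "homogeneous_metric X"
  shows "homogeneous_metric acone"
  unfolding homogeneous_metric_def
proof (intro ballI)
  fix P Q assume PQ: "P \<in> mspace acone" "Q \<in> mspace acone"
  then obtain x y where xy: "x \<in> P" "y \<in> Q" using cone_rep_exists by meson
  note xM = cone_rep_in_space[OF PQ(1) xy(1)] and yM = cone_rep_in_space[OF PQ(2) xy(2)]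
  have "\<exists>f. self_isometry X f \<and> f (x n) = y n" for n
    using X xM yM unfolding homogeneous_metric_def by blast
  then obtain f where f: "\<And>n. self_isometry X (f n)" "\<And>n. f n (x n) = y n" by metis
  have bij: "bij_betw (f n) (mspace X) (mspace X)" for n
    using f by (simp add: self_isometry_def)
  have iso: "mdist X (f n a) (f n b) = mdist X a b" if "a \<in> mspace X" "b \<in> mspace X" for n a b
    using f that by (simp add: self_isometry_def)
  have fM: "f n a \<in> mspace X" if "a \<in> mspace X" for n a
    using bij that by (meson bij_betwE)
  have seqs: "u \<in> cone_seqs X \<omega> e r" if uM: "\<And>n. u n \<in> mspace X" and v: "v \<in> cone_seqs X \<omega> e r"
    and ab: "a \<in> cone_seqs X \<omega> e r" "b \<in> cone_seqs X \<omega> e r"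
    and eq: "\<And>n. mdist X (u n) (a n) = mdist X (v n) (b n)" for u v a b
  proof -
    obtain l where "((\<lambda>n. mdist X (v n) (b n) / r n) \<longlongrightarrow> l) \<omega>"
      using cone_limit_exists[OF D v ab(2)] by blast
    then have "eventually (\<lambda>n. mdist X (v n) (b n) / r n < l + 1) \<omega>"
      by (rule order_tendstoD) simp
    then have "eventually (\<lambda>n. mdist X (u n) (a n) / r n \<le> l + 1) \<omega>"
      by (rule eventually_mono) (simp add: eq)
    then show ?thesis by (rule cone_seqs_boundedI[OF uM ab(1)])
  qed
  note xs = cone_rep_in_seqs[OF PQ(1) xy(1)] and ys = cone_rep_in_seqs[OF PQ(2) xy(2)]
  have push: "(\<lambda>n. f n (u n)) \<in> cone_seqs X \<omega> e r" if u: "u \<in> cone_seqs X \<omega> e r" for u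
  proof (rule seqs[OF _ u ys xs])
    show "f n (u n) \<in> mspace X" for n using u fM by (simp add: cone_seqs_def)
    show "mdist X (f n (u n)) (y n) = mdist X (u n) (x n)" for n
      using iso[of "u n" "x n" n] u xM f(2) by (simp add: cone_seqs_def)
  qed
  define rep where "rep R = (SOME u. u \<in> R)" for R :: "(nat \<Rightarrow> 'a) set"
  have rep: "rep R \<in> R" if "R \<in> mspace acone" for R
    using cone_rep_exists[OF that] unfolding rep_def by (rule someI_ex)
  define F where "F R = cone_class X \<omega> e r (\<lambda>n. f n (rep R n))" for R
  have F: "F R \<in> mspace acone" "(\<lambda>n. f n (rep R n)) \<in> F R" if "R \<in> mspace acone" for R
    using push[OF cone_rep_in_seqs[OF that rep[OF that]]]
    by (simp_all add: F_def cone_class_in in_cone_class)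
  \<comment> \<open>\<open>F\<close> is defined through chosen representatives; any other
    representative gives the same point.\<close>
  have F_eq: "F R = S" if R: "R \<in> mspace acone" "u \<in> R" and S: "S \<in> mspace acone" "v \<in> S"
    and v: "\<And>n. v n = f n (u n)" for R S u v
  proof (rule cone_point_eqI[OF F(1)[OF R(1)] S(1) F(2)[OF R(1)] S(2)])
    have "mdist X (f n (rep R n)) (v n) = mdist X (rep R n) (u n)" for n
      using iso R rep cone_rep_in_space v by simp
    moreover have "((\<lambda>n. mdist X (rep R n) (u n) / r n) \<longlongrightarrow> 0) \<omega>"
      using cone_mdist_tendsto[OF R(1) R(1) rep[OF R(1)] R(2)] R(1) by (simp add: mdist_self)
    ultimately show "((\<lambda>n. mdist X (f n (rep R n)) (v n) / r n) \<longlongrightarrow> 0) \<omega>" by simp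
  qed
  have F_iso: "mdist acone (F R) (F S) = mdist acone R S" if RS: "R \<in> mspace acone" "S \<in> mspace acone" for R S
  proof (rule cone_mdist_eqI[OF F(1)[OF RS(1)] F(1)[OF RS(2)] F(2)[OF RS(1)] F(2)[OF RS(2)]])
    have "mdist X (f n (rep R n)) (f n (rep S n)) = mdist X (rep R n) (rep S n)" for n
      using iso RS rep cone_rep_in_space by simp
    then show "((\<lambda>n. mdist X (f n (rep R n)) (f n (rep S n)) / r n) \<longlongrightarrow> mdist acone R S) \<omega>"
      using cone_mdist_tendsto[OF RS rep[OF RS(1)] rep[OF RS(2)]] by simp
  qed
  have F_surj: "S \<in> F ` mspace acone" if S: "S \<in> mspace acone" for S
  proof -
    define v where "v = rep S"
    note vS = rep[OF S, folded v_def]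
    define u where "u n = inv_into (mspace X) (f n) (v n)" for n
    have vM: "v n \<in> f n ` mspace X" for n
      using bij cone_rep_in_space[OF S vS] by (simp add: bij_betw_def)
    have uM: "u n \<in> mspace X" and fu: "f n (u n) = v n" for n
      using inv_into_into[OF vM] f_inv_into_f[OF vM] by (simp_all add: u_def)
    have "u \<in> cone_seqs X \<omega> e r"
    proof (rule seqs[OF uM cone_rep_in_seqs[OF S vS] xs ys])
      show "mdist X (u n) (x n) = mdist X (v n) (y n)" for n
        using iso[OF uM[of n] xM[of n], of n] by (simp add: fu f(2))
    qed
    then have "cone_class X \<omega> e r u \<in> mspace acone" "u \<in> cone_class X \<omega> e r u"
      by (simp_all add: cone_class_in in_cone_class)
    then show ?thesis using F_eq[OF _ _ S vS] fu by (metis image_eqI)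
  qed
  have "inj_on F (mspace acone)"
  proof (rule inj_onI)
    fix R S assume "R \<in> mspace acone" "S \<in> mspace acone" "F R = F S"
    then show "R = S" using F_iso[of R S] F(1)[of S] by (simp add: mdist_self)
  qed
  then have "self_isometry acone F"
    using F(1) F_surj F_iso unfolding self_isometry_def bij_betw_def by blast
  moreover have "F P = Q" using F_eq[OF PQ(1) xy(1) PQ(2) xy(2)] f(2) by simp
  ultimately show "\<exists>F. self_isometry acone F \<and> F P = Q" by blast
qed

end

section \<open>Blowing up separated pairs\<close>

text \<open>The cone with base points \<open>c\<close> and scales \<open>s\<close> has a global
  cut-point at the class of \<open>c\<close>. Otherwise a chain would join the classes of
  \<open>a\<close> and \<open>b\<close>, and its lift, with fixed length and fixed \<open>t\<close>
  relative to the scale, contradicts \<open>no_chain\<close> at large indices.\<close>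

lemma not_wide_if_separated_pairs:
  assumes D: "cone_data X \<omega> e r"
    and M: "\<And>n. c n \<in> mspace X" "\<And>n. a n \<in> mspace X" "\<And>n. b n \<in> mspace X"
    and s: "\<And>n. real n < s n"
    and a: "\<And>n. s n / 2 < mdist X (a n) (c n)" "\<And>n. mdist X (a n) (c n) < 2 * s n"
    and b: "\<And>n. s n / 2 < mdist X (b n) (c n)" "\<And>n. mdist X (b n) (c n) < 2 * s n"
    and no_chain: "\<And>n. \<not> (avoiding_step X (c n) (s n / real (Suc n)) ^^ Suc n) (a n) (b n)"
  shows "\<not> wide X"
proof
  assume wide: "wide X"
  \<comment> \<open>Reindexing by \<open>N\<close> makes divergence along \<open>\<omega>\<close>
    immediate: it passes from \<open>r\<close> to \<open>N\<close> and then to the scales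
    \<open>s (N n)\<close>.\<close>
  define N where "N n = nat \<lfloor>r n\<rfloor>" for n
  have N: "eventually (\<lambda>n. K < real (N n)) \<omega>" for K
  proof -
    have "eventually (\<lambda>n. K + 1 < r n) \<omega>" using D by (simp add: cone_data_def)
    then show ?thesis
    proof eventually_elim
      case (elim n)
      then show ?case unfolding N_def by linarith
    qed
  qed
  have spos: "0 < s n" for n using s[of n] by (meson le_less_trans of_nat_0_le_iff)
  let ?c = "\<lambda>n. c (N n)" and ?a = "\<lambda>n. a (N n)" and ?b = "\<lambda>n. b (N n)" and ?s = "\<lambda>n. s (N n)"
  have D': "cone_data X \<omega> ?c ?s"
    unfolding cone_data_def
  proof (intro conjI allI)
    show "is_ultrafilter \<omega>" using D by (simp add: cone_data_def)
    fix K show "eventually (\<lambda>n. K < ?s n) \<omega>"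
      using N[of K] by eventually_elim (use s in \<open>meson less_trans\<close>)
  qed (use M spos in auto)
  let ?Y = "asymptotic_cone X \<omega> ?c ?s"
  have seqs: "x \<in> cone_seqs X \<omega> ?c ?s" "1 / 2 \<le> mdist ?Y (cone_class X \<omega> ?c ?s x) (cone_class X \<omega> ?c ?s ?c)"
    if x: "\<And>n. x n \<in> mspace X" "\<And>n. ?s n / 2 < mdist X (x n) (?c n)" "\<And>n. mdist X (x n) (?c n) < 2 * ?s n" for x
  proof -
    note cs = cone_base_in_seqs[OF D']
    show xs: "x \<in> cone_seqs X \<omega> ?c ?s"
    proof (rule cone_seqs_boundedI[OF D' x(1) cs])
      show "eventually (\<lambda>n. mdist X (x n) (?c n) / ?s n \<le> 2) \<omega>"
        using x(3) spos by (intro always_eventually allI) (simp add: pos_divide_le_eq less_imp_le)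
    qed
    show "1 / 2 \<le> mdist ?Y (cone_class X \<omega> ?c ?s x) (cone_class X \<omega> ?c ?s ?c)"
    proof (rule tendsto_lowerbound[OF cone_mdist_tendsto[OF D'] _ cone_nontrivial[OF D']])
      have "1 / 2 \<le> mdist X (x n) (?c n) / ?s n" for n
        using x(2)[of n] spos[of "N n"] by (simp add: pos_le_divide_eq)
      then show "eventually (\<lambda>n. 1 / 2 \<le> mdist X (x n) (?c n) / ?s n) \<omega>" by simp
    qed (use xs cs in \<open>auto simp: cone_class_in[OF D'] in_cone_class[OF D']\<close>)
  qed
  let ?C = "cone_class X \<omega> ?c ?s ?c" and ?A = "cone_class X \<omega> ?c ?s ?a" and ?B = "cone_class X \<omega> ?c ?s ?b"
  note cs = cone_base_in_seqs[OF D']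
  have as: "?a \<in> cone_seqs X \<omega> ?c ?s" and A: "1 / 2 \<le> mdist ?Y ?A ?C"
    using seqs[of ?a] M(2) a by auto
  have bs: "?b \<in> cone_seqs X \<omega> ?c ?s" and B: "1 / 2 \<le> mdist ?Y ?B ?C"
    using seqs[of ?b] M(3) b by auto
  have Y: "?A \<in> mspace ?Y" "?B \<in> mspace ?Y" "?C \<in> mspace ?Y"
    using as bs cs by (auto simp: cone_class_in[OF D'])
  have ne: "P \<noteq> ?C" if "1 / 2 \<le> mdist ?Y P ?C" for P
    using that mdist_self[OF Y(3)] by fastforce
  have "\<not> global_cut_point ?Y ?C" using wide D' unfolding wide_def by blast
  then have "connected_space (subtopology (mtopology_of ?Y) (mspace ?Y - {?C}))"
    using Y by (simp add: global_cut_point_def two_components_iff)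
  from avoiding_chain_exists[OF this Y(3), of ?A ?B] obtain t k where t: "0 < t"
    and k: "(avoiding_step ?Y ?C t ^^ k) ?A ?B"
    using Y ne[OF A] ne[OF B] by blast
  \<comment> \<open>The points \<open>?A\<close> and \<open>?B\<close> have distance at least
    \<open>1 / 2\<close> from \<open>?C\<close>, so this cap permits idle jumps at
    \<open>?A\<close>.\<close>
  define t' where "t' = min t (1 / 2)"
  have t': "0 < t'" "t' \<le> 1 / 2" using t by (auto simp: t'_def)
  have "(avoiding_step ?Y ?C t' ^^ Suc k) ?A ?B"
  proof (rule avoiding_chain_pad)
    show "(avoiding_step ?Y ?C t' ^^ k) ?A ?B"
      by (rule avoiding_chain_antimono[OF k]) (simp add: t'_def)
  qed (use t' A Y in auto)
  moreover have "t' / 2 < t'" using t' by simp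
  ultimately have "eventually (\<lambda>n. (avoiding_step X (?c n) (t' / 2 * ?s n) ^^ Suc k) (?a n) (?b n)) \<omega>"
    by (intro avoiding_chain_lift[OF D' Y(3) in_cone_class[OF D' cs] _ _
          in_cone_class[OF D' as] in_cone_class[OF D' bs]])
  \<comment> \<open>For almost all \<open>n\<close>, \<open>N n\<close> exceeds both
    \<open>k\<close> and \<open>2 / t'\<close>; lowering the radius and padding then turn the lifted
    chain into one excluded by \<open>no_chain\<close>.\<close>
  with N[of "real k"] N[of "2 / t'"] have "eventually (\<lambda>n. False) \<omega>"
  proof eventually_elim
    case (elim n)
    let ?N = "N n"
    have "2 / t' < real (Suc ?N)" using elim(2) by simp
    then have "1 / real (Suc ?N) \<le> t' / 2" using t' by (simp add: field_simps)
    then have le: "?s n / real (Suc ?N) \<le> t' / 2 * ?s n"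
      using mult_right_mono[of "1 / real (Suc ?N)" "t' / 2" "?s n"] spos[of ?N] by simp
    have "t' / 2 * ?s n \<le> 1 / 2 * ?s n"
      using t' spos[of ?N] by (intro mult_right_mono) auto
    then have "?s n / real (Suc ?N) \<le> mdist X (?a n) (?c n)"
      using le a(1)[of ?N] by linarith
    moreover have "Suc k \<le> Suc ?N" using elim(1) by simp
    ultimately have "(avoiding_step X (?c n) (?s n / real (Suc ?N)) ^^ Suc ?N) (?a n) (?b n)"
      using avoiding_chain_pad[OF avoiding_chain_antimono[OF elim(3) le] M(2)] by blast
    then show False using no_chain by blast
  qed
  then show False using cone_nontrivial[OF D] by (simp add: trivial_limit_def)
qed

text \<open>By \<open>avoiding_chain_descend\<close>, a chain missing in the cone is missing in
  \<open>X\<close> at almost every index. The common distance \<open>s\<close> survives only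
  approximately, whence the window from \<open>s / 2\<close> to \<open>2 * s\<close>.\<close>

lemma not_wide_if_separated_pairs_in_cone:
  assumes D: "cone_data X \<omega> e r"
    and sep: "\<And>n. \<exists>P\<in>mspace (asymptotic_cone X \<omega> e r). \<exists>Q\<in>mspace (asymptotic_cone X \<omega> e r).
      \<exists>R\<in>mspace (asymptotic_cone X \<omega> e r). \<exists>s>0.
        mdist (asymptotic_cone X \<omega> e r) Q P = s \<and> mdist (asymptotic_cone X \<omega> e r) R P = s \<and>
        \<not> (avoiding_step (asymptotic_cone X \<omega> e r) P (s / real (Suc n)) ^^ Suc n) Q R"
  shows "\<not> wide X"
proof -
  let ?Y = "asymptotic_cone X \<omega> e r"
  have "\<exists>c\<in>mspace X. \<exists>a\<in>mspace X. \<exists>b\<in>mspace X. \<exists>s. real n < s \<and>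
      s / 2 < mdist X a c \<and> mdist X a c < 2 * s \<and> s / 2 < mdist X b c \<and> mdist X b c < 2 * s \<and>
      \<not> (avoiding_step X c (s / real (Suc n)) ^^ Suc n) a b" for n
  proof -
    obtain P Q R s where Y: "P \<in> mspace ?Y" "Q \<in> mspace ?Y" "R \<in> mspace ?Y" and s: "0 < s"
      "mdist ?Y Q P = s" "mdist ?Y R P = s"
      and no: "\<not> (avoiding_step ?Y P (s / real (Suc n)) ^^ Suc n) Q R"
      using sep[of n] by blast
    obtain p q u where pqu: "p \<in> P" "q \<in> Q" "u \<in> R" using cone_rep_exists[OF D] Y by meson
    have "\<not> eventually (\<lambda>m. (avoiding_step X (p m) (s / real (Suc n) * r m) ^^ Suc n) (q m) (u m)) \<omega>"
    proof
      assume chain: "eventually (\<lambda>m. (avoiding_step X (p m) (s / real (Suc n) * r m) ^^ Suc n) (q m) (u m)) \<omega>"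
      have "0 \<le> s / real (Suc n)" using s(1) by simp
      from avoiding_chain_descend[OF D Y(1) pqu(1) Y(3) pqu(3) this chain Y(2) pqu(2)] no
      show False by blast
    qed
    then have 1: "eventually (\<lambda>m. \<not> (avoiding_step X (p m) (s / real (Suc n) * r m) ^^ Suc n) (q m) (u m)) \<omega>"
      by (rule cone_eventually_not[OF D])
    have 2: "eventually (\<lambda>m. s / 2 < mdist X (x m) (p m) / r m \<and> mdist X (x m) (p m) / r m < 2 * s) \<omega>"
      if "S \<in> mspace ?Y" "x \<in> S" "mdist ?Y S P = s" for S x
    proof -
      have lim: "((\<lambda>m. mdist X (x m) (p m) / r m) \<longlongrightarrow> s) \<omega>"
        using cone_mdist_tendsto[OF D that(1) Y(1) that(2) pqu(1)] that(3) by simp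
      show ?thesis
        by (intro eventually_conj order_tendstoD[OF lim]) (use s in auto)
    qed
    \<comment> \<open>The scale in \<open>X\<close> will be \<open>s * r m\<close>. It can exceed
      \<open>n\<close> however small \<open>s\<close> is, so cones with \<open>s\<close> tending to
      0 are covered.\<close>
    have 3: "eventually (\<lambda>m. real n / s < r m) \<omega>" using D by (simp add: cone_data_def)
    have "eventually (\<lambda>m. \<exists>c\<in>mspace X. \<exists>a\<in>mspace X. \<exists>b\<in>mspace X. \<exists>s. real n < s \<and>
      s / 2 < mdist X a c \<and> mdist X a c < 2 * s \<and> s / 2 < mdist X b c \<and> mdist X b c < 2 * s \<and>
      \<not> (avoiding_step X c (s / real (Suc n)) ^^ Suc n) a b) \<omega>"
      using 1 2[OF Y(2) pqu(2) s(2)] 2[OF Y(3) pqu(3) s(3)] 3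
    proof eventually_elim
      case (elim m)
      note rp = cone_scale_pos[OF D, of m]
      show ?case
      proof (intro bexI exI conjI)
        show "\<not> (avoiding_step X (p m) (s * r m / real (Suc n)) ^^ Suc n) (q m) (u m)"
          using elim(1) by simp
        show "real n < s * r m" using elim(4) s(1) by (simp add: pos_divide_less_eq mult.commute)
        show "s * r m / 2 < mdist X (q m) (p m)" "mdist X (q m) (p m) < 2 * (s * r m)"
          using elim(2) rp by (simp_all add: pos_less_divide_eq pos_divide_less_eq)
        show "s * r m / 2 < mdist X (u m) (p m)" "mdist X (u m) (p m) < 2 * (s * r m)"
          using elim(3) rp by (simp_all add: pos_less_divide_eq pos_divide_less_eq)
      qed (use Y pqu in \<open>auto intro: cone_rep_in_space[OF D]\<close>)
    qed
    then show ?thesis using cone_nontrivial[OF D] by (simp add: eventually_const)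
  qed
  then obtain c a b s where "\<And>n. c n \<in> mspace X \<and> a n \<in> mspace X \<and> b n \<in> mspace X \<and> real n < s n \<and>
      s n / 2 < mdist X (a n) (c n) \<and> mdist X (a n) (c n) < 2 * s n \<and>
      s n / 2 < mdist X (b n) (c n) \<and> mdist X (b n) (c n) < 2 * s n \<and>
      \<not> (avoiding_step X (c n) (s n / real (Suc n)) ^^ Suc n) (a n) (b n)"
    unfolding Bex_def by metis
  then show ?thesis by (intro not_wide_if_separated_pairs[OF D, of c a b s]) blast+
qed

section \<open>Local cut-points, ends and global cut-points\<close>

text \<open>Two components of \<open>U - {p}\<close> both meet every small sphere around
  \<open>p\<close>, and \<open>n + 1\<close> jumps from a small enough sphere stay in a ball inside
  \<open>U\<close>, so they cannot join the components.\<close>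

lemma not_wide_if_local_cut_point:
  assumes X: "geodesic_metric X" and D: "cone_data X \<omega> e r"
    and cut: "local_cut_point (asymptotic_cone X \<omega> e r) p"
  shows "\<not> wide X"
proof (rule not_wide_if_separated_pairs_in_cone[OF D])
  fix n :: nat
  let ?Y = "asymptotic_cone X \<omega> e r"
  note gY = geodesic_cone[OF D X]
  obtain U where U: "openin (mtopology_of ?Y) U" "connectedin (mtopology_of ?Y) U" and p: "p \<in> U"
    and "\<not> connected_space (subtopology (mtopology_of ?Y) (U - {p}))"
    using cut by (auto simp: local_cut_point_def two_components_iff)
  moreover have UY: "U \<subseteq> mspace ?Y" using openin_subset[OF U(1)] by simp
  ultimately obtain a b where ab: "a \<in> U - {p}" "b \<in> U - {p}" "\<not> conn_in ?Y (U - {p}) a b"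
    unfolding connected_space_iff_connected_component by auto
  have pY: "p \<in> mspace ?Y" using p UY by blast
  obtain \<delta> where \<delta>: "0 < \<delta>" "\<And>y. y \<in> mspace ?Y \<Longrightarrow> mdist ?Y p y < \<delta> \<Longrightarrow> y \<in> U"
    using U(1) p unfolding openin_mtopology_of by blast
  \<comment> \<open>The sphere of radius \<open>s\<close> does not lie beyond \<open>a\<close> or
    \<open>b\<close>. The exponent \<open>n + 2\<close>, one more than the number of jumps, makes
    the final bound by \<open>\<delta>\<close> strict.\<close>
  define s where "s = min (min (mdist ?Y a p) (mdist ?Y b p)) (\<delta> / 2 ^ (n + 2))"
  have "0 < mdist ?Y a p" "0 < mdist ?Y b p"
    by (rule mdist_pos; use ab UY pY in blast)+
  then have s: "0 < s" "s \<le> mdist ?Y a p" "s \<le> mdist ?Y b p" using \<delta>(1) by (simp_all add: s_def)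
  have "s \<le> \<delta> / 2 ^ (n + 2)" by (simp add: s_def)
  then have s\<delta>: "2 ^ (n + 2) * s \<le> \<delta>" by (simp add: pos_le_divide_eq mult.commute)
  have sphere: "\<exists>x'. conn_in ?Y (U - {p}) x x' \<and> mdist ?Y x' p = s"
    if x: "x \<in> U - {p}" "s \<le> mdist ?Y x p" for x
  proof -
    obtain c where c: "conn_in ?Y (U - {p}) x c" "mdist ?Y c p < s"
      using local_cut_component_near[OF gY U p x(1) s(1)] by blast
    have "connectedin (mtopology_of ?Y) {y. conn_in ?Y (U - {p}) x y}"
      using connectedin_connected_component_of[of "subtopology (mtopology_of ?Y) (U - {p})" x]
      by (simp add: connectedin_subtopology)
    from connectedin_mdist_ivt[OF this pY, of c s x] show ?thesis
      using c x UY by (auto simp: connected_component_of_refl)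
  qed
  obtain Q R where Q: "conn_in ?Y (U - {p}) a Q" "mdist ?Y Q p = s"
    and R: "conn_in ?Y (U - {p}) b R" "mdist ?Y R p = s"
    using sphere[of a] sphere[of b] ab s by blast
  have QU: "Q \<in> U - {p}" and RU: "R \<in> U - {p}"
    using connected_component_in_topspace[OF Q(1)] connected_component_in_topspace[OF R(1)] by auto
  have "\<not> (avoiding_step ?Y p (s / real (Suc n)) ^^ Suc n) Q R"
  proof
    assume chain: "(avoiding_step ?Y p (s / real (Suc n)) ^^ Suc n) Q R"
    have "conn_in ?Y (U - {p}) Q R"
    proof (rule avoiding_chain_conn_in[OF gY pY _ chain])
      fix w assume w: "w \<in> mspace ?Y" "s / real (Suc n) \<le> mdist ?Y w p"
        "mdist ?Y w p \<le> 2 ^ Suc n * mdist ?Y Q p"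
      have "0 < s / real (Suc n)" using s(1) by simp
      then have "w \<noteq> p" using w(2) mdist_self[OF pY] by auto
      moreover have "2 ^ Suc n * s < 2 ^ (n + 2) * s" using s(1) by simp
      then have "mdist ?Y p w < \<delta>" using w(3) s\<delta> mdist_commute[of ?Y p w] unfolding Q(2) by linarith
      ultimately show "w \<in> U - {p}" using \<delta>(2) w(1) by blast
    qed (use QU UY s in auto)
    then have "conn_in ?Y (U - {p}) a R" by (rule connected_component_of_trans[OF Q(1)])
    moreover have "conn_in ?Y (U - {p}) R b" using R(1) by (simp add: connected_component_of_sym)
    ultimately have "conn_in ?Y (U - {p}) a b" by (rule connected_component_of_trans)
    then show False using ab(3) by blast
  qed
  then show "\<exists>P\<in>mspace ?Y. \<exists>Q\<in>mspace ?Y. \<exists>R\<in>mspace ?Y. \<exists>s>0. mdist ?Y Q P = s \<and> mdist ?Y R P = s \<and>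
      \<not> (avoiding_step ?Y P (s / real (Suc n)) ^^ Suc n) Q R"
    using pY QU RU UY Q(2) R(2) s(1) by blast
qed

section \<open>Ends of the cones of an unbounded space\<close>

lemma cone_ray:
  assumes X: "geodesic_metric X" and unb: "\<not> mbounded_of X (mspace X)" and D: "cone_data X \<omega> e r"
  shows "\<exists>\<rho>. \<rho> ` {0..} \<subseteq> mspace (asymptotic_cone X \<omega> e r) \<and>
    (\<forall>s\<in>{0..}. \<forall>t\<in>{0..}. mdist (asymptotic_cone X \<omega> e r) (\<rho> s) (\<rho> t) = \<bar>s - t\<bar>)"
proof -
  have eM: "e n \<in> mspace X" for n using D by (simp add: cone_data_def)
  \<comment> \<open>The square makes the rescaled distance from \<open>e n\<close> to
    \<open>y n\<close> exceed \<open>r n\<close>, hence diverge, so every \<open>t \<ge> 0\<close>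
    is a valid parameter.\<close>
  have "\<exists>y\<in>mspace X. (r n)\<^sup>2 < mdist X (e n) y" for n
    using unb unfolding mbounded_of_iff[OF eM[of n]] by (metis linorder_not_le mdist_commute order_refl)
  then obtain y where y: "\<And>n. y n \<in> mspace X" "\<And>n. (r n)\<^sup>2 < mdist X (e n) (y n)" by metis
  have "((\<lambda>n. min t (mdist X (e n) (y n) / r n)) \<longlongrightarrow> t) \<omega>" for t
  proof (rule tendsto_eventually)
    have "eventually (\<lambda>n. t < r n) \<omega>" using D by (simp add: cone_data_def)
    then show "eventually (\<lambda>n. min t (mdist X (e n) (y n) / r n) = t) \<omega>"
    proof eventually_elim
      case (elim n)
      have "r n < mdist X (e n) (y n) / r n"
        using y(2)[of n] cone_scale_pos[OF D, of n] by (simp add: pos_less_divide_eq power2_eq_square)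
      then show ?case using elim by simp
    qed
  qed
  then show ?thesis
    using cone_geodesic[where y = y and T = "{0..}", OF D X cone_base_in_seqs[OF D] y(1)] by auto
qed

text \<open>A ray supplies an unbounded component. Two of them would both meet all large spheres
  around \<open>p\<close>, and a chain whose avoided ball contains \<open>B\<close> would join them
  outside \<open>B\<close>; so the pairs on large spheres are separated.\<close>

lemma one_ended_cone_if_wide:
  assumes X: "geodesic_metric X" and unb: "\<not> mbounded_of X (mspace X)" and wide: "wide X"
    and D: "cone_data X \<omega> e r"
  shows "one_ended (asymptotic_cone X \<omega> e r)"
  unfolding one_ended_def
proof (intro allI impI)
  let ?Y = "asymptotic_cone X \<omega> e r"
  note gY = geodesic_cone[OF D X]
  fix B assume "mbounded_of ?Y B"
  let ?T = "subtopology (mtopology_of ?Y) (mspace ?Y - B)"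
  obtain \<rho> where \<rho>: "\<rho> ` {0..} \<subseteq> mspace ?Y"
    "\<And>s t. s \<in> {0..} \<Longrightarrow> t \<in> {0..} \<Longrightarrow> mdist ?Y (\<rho> s) (\<rho> t) = \<bar>s - t\<bar>"
    using cone_ray[OF X unb D] by blast
  define p where "p = \<rho> 0"
  have pY: "p \<in> mspace ?Y" using \<rho>(1) by (auto simp: p_def)
  have \<rho>p: "mdist ?Y (\<rho> t) p = t" if "0 \<le> t" for t using \<rho>(2)[of t 0] that by (simp add: p_def)
  obtain K0 where K0: "\<forall>x\<in>B. mdist ?Y x p \<le> K0"
    using \<open>mbounded_of ?Y B\<close> unfolding mbounded_of_iff[OF pY] by blast
  \<comment> \<open>\<open>K0\<close> may be negative if \<open>B\<close> is empty, while
    \<open>K + 1\<close> has to be a parameter of the ray.\<close>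
  define K where "K = max K0 0"
  have K: "\<And>x. x \<in> B \<Longrightarrow> mdist ?Y x p \<le> K" "0 \<le> K" using K0 by (auto simp: K_def le_max_iff_disj)
  show "\<exists>!C. C \<in> connected_components_of ?T \<and> \<not> mbounded_of ?Y C"
  proof (rule ex_ex1I)
    let ?C = "Collect (connected_component_of ?T (\<rho> (K + 1)))"
    have sub: "\<rho> ` {K + 1..} \<subseteq> mspace ?Y - B"
    proof (rule image_subsetI)
      fix t assume t: "t \<in> {K + 1..}"
      then have "mdist ?Y (\<rho> t) p = t" using \<rho>p K(2) by simp
      then have "\<rho> t \<notin> B" using K(1)[of "\<rho> t"] t by auto
      then show "\<rho> t \<in> mspace ?Y - B" using \<rho>(1) t K(2) by auto
    qed
    have "connectedin (mtopology_of ?Y) (\<rho> ` {K + 1..})"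
      by (rule connectedin_isometric_image) (use \<rho> K(2) in auto)
    then have "connectedin ?T (\<rho> ` {K + 1..})" using sub by (simp add: connectedin_subtopology)
    then have C: "\<rho> ` {K + 1..} \<subseteq> ?C" by (rule connected_component_of_maximal) simp
    have "\<not> mbounded_of ?Y ?C"
    proof
      assume "mbounded_of ?Y ?C"
      then obtain L where L: "\<forall>x\<in>?C. mdist ?Y x p \<le> L" unfolding mbounded_of_iff[OF pY] by blast
      define t where "t = max (K + 1) (L + 1)"
      have "t \<in> {K + 1..}" by (simp add: t_def)
      then have "\<rho> t \<in> ?C" using C by blast
      then have "mdist ?Y (\<rho> t) p \<le> L" using L by blast
      moreover have "mdist ?Y (\<rho> t) p = t" using \<rho>p K(2) by (simp add: t_def)
      ultimately show False by (simp add: t_def)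
    qed
    moreover have "?C \<in> connected_components_of ?T"
      unfolding connected_component_in_connected_components_of using sub by auto
    ultimately show "\<exists>C. C \<in> connected_components_of ?T \<and> \<not> mbounded_of ?Y C" by blast
  next
    fix C1 C2
    assume C1: "C1 \<in> connected_components_of ?T \<and> \<not> mbounded_of ?Y C1"
      and C2: "C2 \<in> connected_components_of ?T \<and> \<not> mbounded_of ?Y C2"
    show "C1 = C2"
    proof (rule ccontr)
      assume ne: "C1 \<noteq> C2"
      obtain c1 c2 where c: "c1 \<in> C1" "c2 \<in> C2"
        using C1 C2 nonempty_connected_components_of by blast
      have sphere: "\<exists>x\<in>C. mdist ?Y x p = s"
        if C: "C \<in> connected_components_of ?T" "\<not> mbounded_of ?Y C" and c: "c \<in> C" "mdist ?Y c p \<le> s"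
        for C c s
      proof -
        have con: "connectedin (mtopology_of ?Y) C"
          using connectedin_connected_components_of[OF C(1)] by (simp add: connectedin_subtopology)
        then have "C \<subseteq> mspace ?Y" using connectedin_subset_topspace by fastforce
        then obtain x where "x \<in> C" "s \<le> mdist ?Y x p"
          using C(2) unfolding mbounded_of_iff[OF pY] by (meson linorder_le_cases)
        then show ?thesis using connectedin_mdist_ivt[OF con pY c] by blast
      qed
      have "\<not> wide X"
      proof (rule not_wide_if_separated_pairs_in_cone[OF D])
        fix n :: nat
        \<comment> \<open>The sphere of radius \<open>s\<close> is reached from \<open>c1\<close>
          and \<open>c2\<close>, and the avoided radius \<open>s / real (Suc n)\<close> is at least
          \<open>K + 1\<close>.\<close>
        define s where "s = max (max (mdist ?Y c1 p) (mdist ?Y c2 p)) ((K + 1) * real (Suc n))"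
        have "0 < (K + 1) * real (Suc n)" using K(2) by simp
        moreover have "(K + 1) * real (Suc n) \<le> s" by (simp add: s_def)
        ultimately have s: "0 < s" "K + 1 \<le> s / real (Suc n)" "mdist ?Y c1 p \<le> s" "mdist ?Y c2 p \<le> s"
          by (simp_all add: pos_le_divide_eq s_def del: of_nat_Suc)
        obtain Q R where Q: "Q \<in> C1" "mdist ?Y Q p = s" and R: "R \<in> C2" "mdist ?Y R p = s"
          using sphere[of C1 c1 s] sphere[of C2 c2 s] C1 C2 c s by blast
        have QR: "Q \<in> mspace ?Y - B" "R \<in> mspace ?Y - B"
          using connected_components_of_subset[of C1 ?T] connected_components_of_subset[of C2 ?T] C1 C2 Q R
          by auto
        have "\<not> (avoiding_step ?Y p (s / real (Suc n)) ^^ Suc n) Q R"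
        proof
          assume chain: "(avoiding_step ?Y p (s / real (Suc n)) ^^ Suc n) Q R"
          have "connected_component_of ?T Q R"
          proof (rule avoiding_chain_conn_in[OF gY pY _ chain])
            fix w assume w: "w \<in> mspace ?Y" "s / real (Suc n) \<le> mdist ?Y w p"
            then have "\<not> mdist ?Y w p \<le> K" using s(2) by linarith
            then show "w \<in> mspace ?Y - B" using K(1) w(1) by blast
          qed (use QR s(1) in auto)
          then obtain S where S: "connectedin ?T S" "Q \<in> S" "R \<in> S"
            unfolding connected_component_of_def by blast
          have "S \<subseteq> C1"
            using connected_components_of_maximal[of C1 ?T S] C1 S Q(1) by (auto simp: disjnt_iff)
          then have "C1 \<inter> C2 \<noteq> {}" using S R(1) by blast
          then show False using connected_components_of_overlap[of C1 ?T C2] C1 C2 ne by blast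
        qed
        then show "\<exists>P\<in>mspace ?Y. \<exists>Q\<in>mspace ?Y. \<exists>R\<in>mspace ?Y. \<exists>s>0.
            mdist ?Y Q P = s \<and> mdist ?Y R P = s \<and> \<not> (avoiding_step ?Y P (s / real (Suc n)) ^^ Suc n) Q R"
          using pY QR Q(2) R(2) s(1) by blast
      qed
      then show False using wide by blast
    qed
  qed
qed

section \<open>Global cut-points of homogeneous geodesic spaces\<close>

lemma geodesic_through_cut_point:
  assumes M: "geodesic_metric M" and x: "x \<in> mspace M" and y: "y \<in> mspace M"
    and cut: "\<not> conn_in M (mspace M - {q}) x y"
  shows "mdist M x y = mdist M x q + mdist M q y"
proof (rule ccontr)
  assume "mdist M x y \<noteq> mdist M x q + mdist M q y"
  \<comment> \<open>Without equality, \<open>q\<close> lies on no geodesic from \<open>x\<close> to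
    \<open>y\<close>.\<close>
  then have "conn_in M (mspace M - {q}) x y"
    by (intro geodesic_conn_in[OF M x y]) auto
  then show False using cut by blast
qed

lemma conn_in_isometry:
  assumes f: "self_isometry M f" and p: "p \<in> mspace M" and x: "x \<in> mspace M" and y: "y \<in> mspace M"
    and c: "conn_in M (mspace M - {f p}) (f x) (f y)"
  shows "conn_in M (mspace M - {p}) x y"
proof -
  have bij: "bij_betw f (mspace M) (mspace M)"
    and iso: "\<And>u v. u \<in> mspace M \<Longrightarrow> v \<in> mspace M \<Longrightarrow> mdist M (f u) (f v) = mdist M u v"
    using f by (auto simp: self_isometry_def)
  define g where "g = inv_into (mspace M) f"
  have g: "g z \<in> mspace M" "f (g z) = z" if "z \<in> mspace M" for z
    using bij that by (auto simp: g_def bij_betw_def inv_into_into f_inv_into_f)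
  have gf: "g (f z) = z" if "z \<in> mspace M" for z
    using bij that by (simp add: g_def bij_betw_def)
  have "mdist M (g u) (g v) = mdist M u v" if "u \<in> mspace M" "v \<in> mspace M" for u v
    using iso[of "g u" "g v"] g that by simp
  then have "Lipschitz_continuous_map M M g"
    using g(1) by (auto simp: Lipschitz_continuous_map_def intro!: exI[of _ 1])
  then have g_cont: "continuous_map (mtopology_of M) (mtopology_of M) g"
    by (rule Lipschitz_continuous_imp_continuous_map)
  obtain T where T: "connectedin (mtopology_of M) T" "T \<subseteq> mspace M - {f p}" "f x \<in> T" "f y \<in> T"
    using c by (auto simp: connected_component_of_def connectedin_subtopology)
  have "g ` T \<subseteq> mspace M - {p}" using T(2) g by force
  moreover have "connectedin (mtopology_of M) (g ` T)"
    by (rule connectedin_continuous_map_image[OF g_cont T(1)])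
  moreover have "x \<in> g ` T" "y \<in> g ` T" using T(3,4) gf x y by (metis image_eqI)+
  ultimately show ?thesis by (auto simp: connected_component_of_def connectedin_subtopology)
qed

text \<open>
  If the component of \<open>a\<close> were bounded, move the cut-point to a point \<open>q\<close> of it almost
  as far from \<open>p\<close> as possible: a component of the complement of \<open>q\<close> that does not contain \<open>p\<close>
  lies beyond \<open>q\<close>, hence reaches too far.
\<close>

lemma cut_point_component_unbounded:
  assumes M: "geodesic_metric M" "homogeneous_metric M" and p: "p \<in> mspace M"
    and a: "a \<in> mspace M - {p}" and b: "b \<in> mspace M - {p}"
    and cut: "\<not> conn_in M (mspace M - {p}) a b"
  shows "\<exists>x. conn_in M (mspace M - {p}) a x \<and> K < mdist M x p"
proof (rule ccontr)
  let ?c = "conn_in M (mspace M - {p})"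
  assume "\<not> ?thesis"
  then have bd: "\<And>x. ?c a x \<Longrightarrow> mdist M x p \<le> K" by force
  define S where "S = (\<lambda>x. mdist M x p) ` {x. ?c a x}"
  have aa: "?c a a" using a by (simp add: connected_component_of_refl)
  have "bdd_above S" using bd by (auto simp: S_def intro!: bdd_aboveI[of _ K])
  then have le: "mdist M x p \<le> Sup S" if "?c a x" for x
    using that by (auto simp: S_def intro!: cSup_upper)
  have "0 < Sup S" using le[OF aa] mdist_pos[of a M p] a p by auto
  moreover have "0 < mdist M b p" using mdist_pos[of b M p] b p by auto
  \<comment> \<open>The two bounds belong to the two candidates \<open>f b\<close> and
    \<open>f q\<close> for a point beyond \<open>q\<close>, at distances \<open>mdist M b p\<close>
    and \<open>mdist M q p\<close> from \<open>q\<close>.\<close>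
  ultimately have "max (Sup S - mdist M b p) (Sup S / 2) < Sup S" by simp
  moreover have "S \<noteq> {}" using aa by (auto simp: S_def)
  ultimately obtain d where "d \<in> S" "max (Sup S - mdist M b p) (Sup S / 2) < d"
    by (rule less_cSupE)
  then obtain q where q: "?c a q" "max (Sup S - mdist M b p) (Sup S / 2) < mdist M q p"
    unfolding S_def by blast
  have qM: "q \<in> mspace M - {p}" using connected_component_in_topspace[OF q(1)] by auto
  obtain f where f: "self_isometry M f" "f p = q"
    using M(2) p qM unfolding homogeneous_metric_def by blast
  have fM: "f x \<in> mspace M" if "x \<in> mspace M" for x
    using f(1) that unfolding self_isometry_def by (blast dest: bij_betwE)
  have beyond: "mdist M p q + mdist M x p \<le> Sup S"
    if x: "x \<in> mspace M" and sep: "\<not> conn_in M (mspace M - {q}) p (f x)" for x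
  proof -
    have fx: "mdist M p (f x) = mdist M p q + mdist M q (f x)"
      by (rule geodesic_through_cut_point[OF M(1) p fM[OF x] sep])
    \<comment> \<open>If \<open>p\<close> separated \<open>q\<close> from \<open>f x\<close>, then
      \<open>p\<close> would lie between \<open>q\<close> and \<open>f x\<close> while
      \<open>q\<close> lies between \<open>p\<close> and \<open>f x\<close>, which forces
      \<open>p = q\<close>.\<close>
    have "?c q (f x)"
    proof (rule ccontr)
      assume "\<not> ?c q (f x)"
      then have "mdist M q (f x) = mdist M q p + mdist M p (f x)"
        using geodesic_through_cut_point[OF M(1) _ fM[OF x]] qM by blast
      then show False using fx mdist_pos[of q M p] mdist_commute[of M p q] qM p by auto
    qed
    then have "?c a (f x)" by (rule connected_component_of_trans[OF q(1)])
    then have "mdist M p (f x) \<le> Sup S" using le[of "f x"] mdist_commute[of M p "f x"] by simp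
    moreover have "mdist M q (f x) = mdist M x p"
      using f p x unfolding self_isometry_def by (metis mdist_commute)
    ultimately show ?thesis using fx by simp
  qed
  have "\<not> ?c q b"
    using cut connected_component_of_trans[OF q(1)] by blast
  then have "\<not> conn_in M (mspace M - {q}) (f q) (f b)"
    using conn_in_isometry[OF f(1) p] f(2) qM b by blast
  \<comment> \<open>Since \<open>q\<close> separates \<open>f q\<close> from \<open>f b\<close>, it
    separates \<open>p\<close> from at least one of them.\<close>
  then have "\<not> conn_in M (mspace M - {q}) p (f q) \<or> \<not> conn_in M (mspace M - {q}) p (f b)"
    by (metis connected_component_of_sym connected_component_of_trans)
  then show False
    using beyond[of q] beyond[of b] q(2) qM b mdist_commute[of M p q] by auto
qed

text \<open>For the bounded set \<open>{p}\<close>, the components of two separated points would be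
  two distinct unbounded components.\<close>

lemma no_global_cut_point_if_one_ended:
  assumes M: "geodesic_metric M" "homogeneous_metric M" and one: "one_ended M"
  shows "\<not> global_cut_point M p"
proof
  assume cut: "global_cut_point M p"
  let ?T = "subtopology (mtopology_of M) (mspace M - {p})"
  have p: "p \<in> mspace M" using cut by (simp add: global_cut_point_def)
  obtain a b where ab: "a \<in> mspace M - {p}" "b \<in> mspace M - {p}" "\<not> connected_component_of ?T a b"
    using cut unfolding global_cut_point_def two_components_iff connected_space_iff_connected_component
    by auto
  have unb: "Collect (connected_component_of ?T x) \<in> connected_components_of ?T \<and>
      \<not> mbounded_of M (Collect (connected_component_of ?T x))"
    if "x \<in> mspace M - {p}" "y \<in> mspace M - {p}" "\<not> connected_component_of ?T x y" for x y
  proof -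
    have "\<exists>z\<in>Collect (connected_component_of ?T x). K < mdist M z p" for K
      using cut_point_component_unbounded[OF M p that] by blast
    then have "\<not> mbounded_of M (Collect (connected_component_of ?T x))"
      unfolding mbounded_of_iff[OF p] by (meson linorder_not_le)
    then show ?thesis using that(1) by (simp add: connected_component_in_connected_components_of)
  qed
  have "mbounded_of M {p}"
    unfolding mbounded_of_iff[OF p] using p by auto
  then have "\<exists>!C. C \<in> connected_components_of ?T \<and> \<not> mbounded_of M C"
    using one unfolding one_ended_def by blast
  then have "Collect (connected_component_of ?T a) = Collect (connected_component_of ?T b)"
    using unb[of a b] unb[of b a] ab by (auto simp: connected_component_of_sym)
  then show False
    using ab by (auto simp: set_eq_iff connected_component_of_refl)
qed

lemma local_cut_point_if_global:
  assumes "geodesic_metric M" and "global_cut_point M p"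
  shows "local_cut_point M p"
  unfolding local_cut_point_def
proof (intro exI[of _ "mspace M"] conjI)
  show "openin (mtopology_of M) (mspace M)" using openin_topspace[of "mtopology_of M"] by simp
  show "connectedin (mtopology_of M) (mspace M)"
    using connected_space_geodesic[OF assms(1)] connectedin_topspace[of "mtopology_of M"] by simp
qed (use assms(2) in \<open>auto simp: global_cut_point_def\<close>)

text \<open>Cones of a bounded space are single points: they have no cut-points, but no unbounded
  component either. The equivalence with one-endedness is therefore stated for unbounded
  \<open>X\<close>.\<close>

theorem proposition2p12:
  fixes X :: "'a metric"
  assumes "geodesic_metric X" and "homogeneous_metric X"
  shows "(\<not> mbounded_of X (mspace X) \<longrightarrow>
            ((\<forall>\<omega> e r. cone_data X \<omega> e r \<longrightarrow> one_ended (asymptotic_cone X \<omega> e r)) \<longleftrightarrow> wide X))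
         \<and> (wide X \<longleftrightarrow>
            (\<forall>\<omega> e r. cone_data X \<omega> e r \<longrightarrow>
               \<not> (\<exists>p. local_cut_point (asymptotic_cone X \<omega> e r) p)))"
proof (intro conjI impI iffI)
  assume one: "\<forall>\<omega> e r. cone_data X \<omega> e r \<longrightarrow> one_ended (asymptotic_cone X \<omega> e r)"
  show "wide X"
    unfolding wide_def
  proof (intro allI impI notI, elim exE)
    fix \<omega> e r p assume D: "cone_data X \<omega> e r" and "global_cut_point (asymptotic_cone X \<omega> e r) p"
    moreover have "one_ended (asymptotic_cone X \<omega> e r)" using one D by blast
    ultimately show False
      using no_global_cut_point_if_one_ended[OF geodesic_cone[OF D assms(1)] homogeneous_cone[OF D assms(2)]]
      by blast
  qed
next
  assume "\<not> mbounded_of X (mspace X)" "wide X"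
  then show "\<forall>\<omega> e r. cone_data X \<omega> e r \<longrightarrow> one_ended (asymptotic_cone X \<omega> e r)"
    using one_ended_cone_if_wide assms(1) by blast
next
  assume "wide X"
  then show "\<forall>\<omega> e r. cone_data X \<omega> e r \<longrightarrow> \<not> (\<exists>p. local_cut_point (asymptotic_cone X \<omega> e r) p)"
    using not_wide_if_local_cut_point assms(1) by blast
next
  assume no_cut: "\<forall>\<omega> e r. cone_data X \<omega> e r \<longrightarrow> \<not> (\<exists>p. local_cut_point (asymptotic_cone X \<omega> e r) p)"
  show "wide X"
    unfolding wide_def
  proof (intro allI impI notI, elim exE)
    fix \<omega> e r p assume D: "cone_data X \<omega> e r" and cut: "global_cut_point (asymptotic_cone X \<omega> e r) p"
    have "local_cut_point (asymptotic_cone X \<omega> e r) p"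
      by (rule local_cut_point_if_global[OF geodesic_cone[OF D assms(1)] cut])
    then show False using no_cut D by blast
  qed
qed

end
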